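(* Let $\mathbb{K}$ be a field and let $G$ be a finite simple graph with vertex set $\{v_1,\dots,v_\ell\}$. The graphic arrangement $\mathcal{A}_G=\{\ker(x_i-x_j) \mid \{v_i,v_j\}\in E_G\}$ in $\mathbb{K}^\ell$ is MAT-free if and only if $G$ is strongly chordal.
   Context: An arrangement is a finite set of linear hyperplanes in $V=\mathbb{K}^\ell$. For a subset $\mathcal{B}\subseteq\mathcal{A}$, $\operatorname{rank}(\mathcal{B})$ is the codimension of $\bigcap_{H\in\mathcal{B}}H$ (with the empty intersection equal to $V$). For $H\in\mathcal{A}$, the restriction is $\mathcal{A}^H=\{K\cap H\mid K\in\mathcal{A}\setminus\{H\}\}$ (an arrangement in $H$). A partition $\pi=(\pi_1,\dots,\pi_n)$ of a nonempty arrangement $\mathcal{A}$ into nonempty blocks is an MAT-partition if for every $k\in[n]$, writing $\mathcal{A}_{k-1}=\pi_1\sqcup\dots\sqcup\pi_{k-1}$ ($\mathcal{A}_0=\varnothing$): (MP1) $\operatorname{rank}(\pi_k)=|\pi_k|$; (MP2) there is no $H'\in\mathcal{A}_{k-1}$ with $\bigcap_{H\in\pi_k}H\subseteq H'$; (MP3) for each $H\in\pi_k$, $|\mathcal{A}_{k-1}|-|(\mathcal{A}_{k-1}\cup\{H\})^H|=k-1$. An arrangement is MAT-free if it is empty or admits an MAT-partition. A graph is chordal if it has no induced cycle of length greater than three. For $n\ge3$, the $n$-sun $S_n$ is the graph on $\{u_1,\dots,u_n\}\cup\{w_1,\dots,w_n\}$ with edges $\{u_i,u_j\}$ for all $i<j$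 and $\{w_i,u_i\},\{w_i,u_{i+1}\}$ for all $i$ (indices mod $n$, $u_{n+1}=u_1$). A graph is strongly chordal if it is chordal and contains no induced subgraph isomorphic to $S_n$ for any $n\ge3$. *)

theory Defs
  imports "HOL-Analysis.Analysis" "HOL-Library.Disjoint_Sets"
begin

section \<open>Hyperplane arrangements and MAT-freeness\<close>

definition codim :: "('k::field ^ 'n) set \<Rightarrow> nat" where
  "codim S = CARD('n) - vec.dim S"

definition linear_hyperplane :: "('k::field ^ 'n) set \<Rightarrow> bool" where
  "linear_hyperplane H \<longleftrightarrow> vec.subspace H \<and> codim H = 1"

definition arrangement :: "('k::field ^ 'n) set set \<Rightarrow> bool" where
  "arrangement A \<longleftrightarrow> finite A \<and> (\<forall>H\<in>A. linear_hyperplane H)"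

definition arr_rank :: "('k::field ^ 'n) set set \<Rightarrow> nat" where
  "arr_rank B = codim (\<Inter>B)"

definition restriction :: "('k::field ^ 'n) set set \<Rightarrow> ('k ^ 'n) set \<Rightarrow> ('k ^ 'n) set set" where
  "restriction A H = {K \<inter> H | K. K \<in> A - {H}}"

text \<open>The blocks are counted from 0: \<open>\<pi> ! k\<close> is the block $\pi_{k+1}$ and
  \<open>\<Union>(set (take k \<pi>))\<close> is $\pi_1 \sqcup \dots \sqcup \pi_k$, so the defect required of the
  hyperplanes in \<open>\<pi> ! k\<close> is \<open>k\<close>. The difference is taken in the integers to avoid
  truncated subtraction.\<close>

definition MAT_partition :: "('k::field ^ 'n) set set \<Rightarrow> ('k ^ 'n) set set list \<Rightarrow> bool" where
  "MAT_partition A \<pi> \<longleftrightarrow>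
     arrangement A \<and> A \<noteq> {} \<and> distinct \<pi> \<and> partition_on A (set \<pi>) \<and>
     (\<forall>k<length \<pi>. let B = \<Union>(set (take k \<pi>)) in
        arr_rank (\<pi> ! k) = card (\<pi> ! k) \<and>
        \<not> (\<exists>H'\<in>B. \<Inter>(\<pi> ! k) \<subseteq> H') \<and>
        (\<forall>H\<in>\<pi> ! k. int (card B) - int (card (restriction (B \<union> {H}) H)) = int k))"

definition MAT_free :: "('k::field ^ 'n) set set \<Rightarrow> bool" where
  "MAT_free A \<longleftrightarrow> A = {} \<or> (\<exists>\<pi>. MAT_partition A \<pi>)"


section \<open>Simple graphs and strong chordality\<close>

type_synonym 'a graph = "'a set \<times> 'a set set"

abbreviation verts :: "'a graph \<Rightarrow> 'a set" where "verts G \<equiv> fst G"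
abbreviation edges :: "'a graph \<Rightarrow> 'a set set" where "edges G \<equiv> snd G"

definition finite_simple_graph :: "'a graph \<Rightarrow> bool" where
  "finite_simple_graph G \<longleftrightarrow>
     finite (verts G) \<and> (\<forall>e\<in>edges G. e \<subseteq> verts G \<and> card e = 2)"

definition induced_subgraph :: "'a graph \<Rightarrow> 'a set \<Rightarrow> 'a graph" where
  "induced_subgraph G W = (W, {e \<in> edges G. e \<subseteq> W})"

definition graph_iso :: "'a graph \<Rightarrow> 'b graph \<Rightarrow> bool" where
  "graph_iso G H \<longleftrightarrow>
     (\<exists>f. bij_betw f (verts G) (verts H) \<and>
          (\<forall>x\<in>verts G. \<forall>y\<in>verts G. {x, y} \<in> edges G \<longleftrightarrow> {f x, f y} \<in> edges H))"

definition has_induced :: "'a graph \<Rightarrow> 'b graph \<Rightarrow> bool" where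
  "has_induced G H \<longleftrightarrow> (\<exists>W\<subseteq>verts G. graph_iso (induced_subgraph G W) H)"

definition cycle_graph :: "nat \<Rightarrow> nat graph" where
  "cycle_graph n = ({..<n}, {{i, (i + 1) mod n} | i. i < n})"

definition chordal :: "'a graph \<Rightarrow> bool" where
  "chordal G \<longleftrightarrow> \<not> (\<exists>n>3. has_induced G (cycle_graph n))"

text \<open>\<open>Inl i\<close> is the clique vertex $u_{i+1}$ and \<open>Inr i\<close> is the outer vertex $w_{i+1}$.\<close>

definition sun_graph :: "nat \<Rightarrow> (nat + nat) graph" where
  "sun_graph n =
     (Inl ` {..<n} \<union> Inr ` {..<n},
      {{Inl i, Inl j} | i j. i < j \<and> j < n} \<union>
      {{Inr i, Inl i} | i. i < n} \<union>
      {{Inr i, Inl ((i + 1) mod n)} | i. i < n})"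

definition strongly_chordal :: "'a graph \<Rightarrow> bool" where
  "strongly_chordal G \<longleftrightarrow> chordal G \<and> \<not> (\<exists>n\<ge>3. has_induced G (sun_graph n))"


section \<open>Graphic arrangements\<close>

text \<open>The vertex $v_i$ is identified with the coordinate index \<open>i :: 'n\<close>.\<close>

definition graphic_arrangement :: "'n::finite graph \<Rightarrow> ('k::field ^ 'n) set set" where
  "graphic_arrangement G = {{x. x $ i - x $ j = 0} | i j. {i, j} \<in> edges G}"

end

theory Submission
  imports Defs
begin

text \<open>
  The intersection of a set of hyperplanes \<open>x\<^sub>i = x\<^sub>j\<close> lies in \<open>x\<^sub>u = x\<^sub>v\<close> iff \<open>u\<close> and \<open>v\<close> are
  connected by the corresponding edges, so an MAT-partition is an edge labeling in which every label
  class is a forest, no edge of smaller label joins two vertices connected by label \<open>k\<close>, and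
  every edge of label \<open>k\<close> is in exactly \<open>k\<close> triangles whose other two edges have smaller label
  (labels start at 0).

  Given such a labeling, induction on \<open>k\<close> shows that the graph of the edges of label less than \<open>k\<close>
  is chordal with cliques of size at most \<open>k + 1\<close>, and that the largest label in a clique occurs
  once. Hence, if \<open>w\<close> is adjacent to both ends of an edge \<open>e\<close>, then all vertices forming a
  lower-labeled triangle with \<open>e\<close> are equal or adjacent to \<open>w\<close>. In a sun, the rim edge of largest label
  has such a triangle inside the central clique, which contradicts the outer vertex at that edge.

  Conversely, the maximal cliques of a strongly chordal graph form a totally balanced family, and
  such a family has a nest point \<open>v\<close>, that is, the members containing \<open>v\<close> form a chain. Delete \<open>v\<close>,
  label the rest, and order the neighbours of \<open>v\<close> compatibly with the chain; labeling the edges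
  at \<open>v\<close> by 0, 1, 2, ... in this order extends the labeling. The invariant that makes this possible
  is that every member of the family carries an MAT-labeling of its own.
\<close>

section \<open>Walks, holes and cliques\<close>

text \<open>Cliques and holes control each other. An edge of label \<open>k\<close> with its
  \<open>k\<close> apexes is a clique of \<open>k + 2\<close> vertices, the largest size that labels
  up to \<open>k\<close> allow. If label \<open>k\<close> created a hole, either the hole would be a
  cycle inside one label class, or the apexes of one of its edges would extend to a clique that is
  too large even for the labels below \<open>k\<close>. Hence hole-freeness and the clique bound
  have to pass through the induction together.

  In the converse direction the induction runs over set families instead of graphs: once a nest
  point is deleted, the traces of the maximal cliques need no longer be maximal cliques, but they
  still form a totally balanced family. A new edge from \<open>v\<close> to the neighbour at
  position \<open>j\<close> gets label \<open>j\<close>, and it has the required \<open>j\<close>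
  triangles only if the earlier neighbours are joined to that neighbour by labels less than
  \<open>j\<close>. Ordering the neighbours so that every prefix is a vine guarantees this, and
  making the members through \<open>v\<close> prefixes keeps those members vines after
  \<open>v\<close> has been added.\<close>

lemma rtranclp_two_steps: "R a b \<Longrightarrow> R b c \<Longrightarrow> R\<^sup>*\<^sup>* a c"
  by (rule converse_rtranclp_into_rtranclp) blast+

text \<open>\<open>g\<close> has least length among the walks from \<open>P\<close> to
  \<open>Q\<close> that use only vertices of \<open>f\<close>, so that properties of the given
  vertices pass to it. Only forward chords are excluded, since \<open>R\<close> may be
  asymmetric.\<close>

lemma shortest_walk:
  fixes f :: "nat \<Rightarrow> 'b"
  assumes "f 0 \<in> P" "f m \<in> Q" "\<And>i. i < m \<Longrightarrow> R (f i) (f (Suc i))"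
  obtains g n where "g ` {..n} \<subseteq> f ` {..m}" "g 0 \<in> P" "g n \<in> Q"
    "\<And>i. i < n \<Longrightarrow> R (g i) (g (Suc i))"
    "\<And>i. i \<le> n \<Longrightarrow> g i \<in> P \<Longrightarrow> i = 0"
    "\<And>i. i \<le> n \<Longrightarrow> g i \<in> Q \<Longrightarrow> i = n"
    "\<And>i j. i < j \<Longrightarrow> j \<le> n \<Longrightarrow> R (g i) (g j) \<Longrightarrow> j = Suc i"
    "\<And>i j. i < j \<Longrightarrow> j \<le> n \<Longrightarrow> g i \<noteq> g j"
proof -
  define W where "W g n \<longleftrightarrow> g ` {..n} \<subseteq> f ` {..m} \<and> g 0 \<in> P \<and> g n \<in> Q \<and> (\<forall>i<n. R (g i) (g (Suc i)))"
    for g n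
  have "\<exists>n g. W g n"
    using assms unfolding W_def by blast
  then obtain n where n: "\<exists>g. W g n" "\<And>k. k < n \<Longrightarrow> \<not> (\<exists>g. W g k)"
    using exists_least_iff[of "\<lambda>n. \<exists>g. W g n"] by blast
  then obtain g where g: "W g n" by blast
  have g1: "g ` {..n} \<subseteq> f ` {..m}" "g 0 \<in> P" "g n \<in> Q"
      "\<And>i. i < n \<Longrightarrow> R (g i) (g (Suc i))"
    using g unfolding W_def by auto
  have gim: "g i \<in> f ` {..m}" if "i \<le> n" for i using g1(1) that by blast
  have P: "i = 0" if "i \<le> n" "g i \<in> P" for i
  proof (rule ccontr)
    assume "i \<noteq> 0"
    moreover have "W (\<lambda>t. g (t + i)) (n - i)"
      unfolding W_def using that g1 gim by auto
    ultimately show False using n(2)[of "n - i"] that by auto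
  qed
  have Q: "i = n" if "i \<le> n" "g i \<in> Q" for i
  proof (rule ccontr)
    assume "i \<noteq> n"
    moreover have "W g i"
      unfolding W_def using that g1 gim by auto
    ultimately show False using n(2)[of i] that by auto
  qed
  have R: "j = Suc i" if "i < j" "j \<le> n" "R (g i) (g j)" for i j
  proof (rule ccontr)
    assume ne: "j \<noteq> Suc i"
    define d where "d = j - Suc i"
    have d: "j = Suc i + d" "d > 0" using that ne by (auto simp: d_def)
    \<comment> \<open>\<open>h\<close> takes the chord and skips the \<open>d\<close> vertices
      strictly between positions \<open>i\<close> and \<open>j\<close>.\<close>
    define h where "h t = (if t \<le> i then g t else g (t + d))" for t
    have "W h (n - d)"
      unfolding W_def
    proof (intro conjI allI impI)
      show "h ` {..n - d} \<subseteq> f ` {..m}" using gim d that by (auto simp: h_def)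
      show "h 0 \<in> P" using g1 by (simp add: h_def)
      show "h (n - d) \<in> Q" using g1 d that by (auto simp: h_def)
      fix t assume t: "t < n - d"
      consider "t < i" | "t = i" | "t > i" by linarith
      then show "R (h t) (h (Suc t))"
      proof cases
        case 1 then show ?thesis using g1(4)[of t] t by (simp add: h_def)
      next
        case 2 then show ?thesis using that d by (simp add: h_def)
      next
        case 3 then show ?thesis using g1(4)[of "t + d"] t by (simp add: h_def)
      qed
    qed
    then show False using n(2)[of "n - d"] d that by auto
  qed
  have inj: "g i \<noteq> g j" if "i < j" "j \<le> n" for i j
  proof
    assume eq: "g i = g j"
    \<comment> \<open>A repeated vertex makes the step out of the predecessor of \<open>g i\<close>
      a forward chord to \<open>g j\<close>; for \<open>i = 0\<close> it would be a second visit to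
      \<open>P\<close>.\<close>
    show False
    proof (cases i)
      case 0 then show ?thesis using P[of j] eq g1 that by auto
    next
      case (Suc k)
      then have "R (g k) (g j)" using g1(4)[of k] eq that by auto
      then show ?thesis using R[of k j] that Suc by auto
    qed
  qed
  show ?thesis using that[OF g1 P Q R inj] by blast
qed

lemma shift_mod_eq_iff:
  fixes i j n s :: nat
  assumes "i < n" "j < n"
  shows "(i + s) mod n = (j + s) mod n \<longleftrightarrow> i = j"
proof
  assume "(i + s) mod n = (j + s) mod n"
  then have "int (i + s) mod int n = int (j + s) mod int n" by (metis zmod_int)
  then have "int n dvd int i - int j" by (simp add: mod_eq_dvd_iff)
  then show "i = j" using assms dvd_imp_le_int[of "int i - int j" "int n"] by (cases "i = j") auto
qed simp

lemma shift_mod_Suc: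
  fixes i n s :: nat
  shows "((i + s) mod n + 1) mod n = ((i + 1) mod n + s) mod n"
  by (simp add: mod_simps ac_simps)

definition induced_cycle :: "('a \<Rightarrow> 'a \<Rightarrow> bool) \<Rightarrow> nat \<Rightarrow> (nat \<Rightarrow> 'a) \<Rightarrow> bool" where
  "induced_cycle R n f \<longleftrightarrow> inj_on f {..<n} \<and>
     (\<forall>i<n. \<forall>j<n. R (f i) (f j) \<longleftrightarrow> j = (i + 1) mod n \<or> i = (j + 1) mod n)"

definition hole_free :: "('a \<Rightarrow> 'a \<Rightarrow> bool) \<Rightarrow> bool" where
  "hole_free R \<longleftrightarrow> \<not> (\<exists>n>3. \<exists>f. induced_cycle R n f)"

lemma induced_cycleI:
  assumes "symp R" "irreflp R" "n > 2"
    and "\<And>i j. i < j \<Longrightarrow> j < n \<Longrightarrow> f i \<noteq> f j"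
    and "\<And>i j. i < j \<Longrightarrow> j < n \<Longrightarrow> R (f i) (f j) \<longleftrightarrow> j = Suc i \<or> i = 0 \<and> Suc j = n"
  shows "induced_cycle R n f"
  unfolding induced_cycle_def
proof (intro conjI allI impI)
  show "inj_on f {..<n}"
    using assms(4) by (intro linorder_inj_onI) auto
next
  fix i j assume ij: "i < n" "j < n"
  have m: "Suc i mod n = (if Suc i = n then 0 else Suc i)" if "i < n" for i
    using that by auto
  have "R (f i) (f j) \<longleftrightarrow> R (f j) (f i)" using assms(1) by (auto dest: sympD)
  moreover have "\<not> R (f i) (f i)" using assms(2) by (auto dest: irreflpD)
  ultimately show "R (f i) (f j) \<longleftrightarrow> j = (i + 1) mod n \<or> i = (j + 1) mod n"
    using ij assms(3) assms(5)[of i j] assms(5)[of j i]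
    by (cases i j rule: linorder_cases) (auto simp: m split: if_splits)
qed

lemma hole_free_four_cycle:
  assumes "hole_free R" "symp R" "irreflp R"
    and "R a b" "R b c" "R c d" "R d a" "a \<noteq> c" "b \<noteq> d"
  shows "R a c \<or> R b d"
proof (rule ccontr)
  assume n: "\<not> (R a c \<or> R b d)"
  define f :: "nat \<Rightarrow> 'a" where "f = (\<lambda>i. [a, b, c, d] ! i)"
  have s: "R x y \<longleftrightarrow> R y x" for x y using assms(2) by (auto dest: sympD)
  have ir: "\<not> R x x" for x using assms(3) by (auto dest: irreflpD)
  have "induced_cycle R 4 f"
  proof (rule induced_cycleI)
    fix i j :: nat assume "i < j" "j < 4"
    then have "(i, j) \<in> {(0,1), (0,2), (0,3), (1,2), (1,3), (2,3)}" by auto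
    then show "f i \<noteq> f j" "R (f i) (f j) \<longleftrightarrow> j = Suc i \<or> i = 0 \<and> Suc j = 4"
      using assms(4-9) n ir s[of a d]
      by (auto simp: f_def numeral_2_eq_2 numeral_3_eq_3)
  qed (use assms in auto)
  moreover have "(4::nat) > 3" by simp
  ultimately show False using assms(1) unfolding hole_free_def by blast
qed

text \<open>A shortest walk from the neighbours of \<open>u\<close> to the neighbours of
  \<open>v\<close> meets each neighbourhood only once, so it closes through \<open>v\<close> and
  \<open>u\<close> to an induced cycle. Hole-freeness reduces it to a single vertex, which is a
  common neighbour.\<close>

lemma hole_free_walk_triangle:
  assumes "hole_free R" "symp R" "irreflp R" "R u v"
    and "R u (f 0)" "R v (f m)" "\<And>i. i < m \<Longrightarrow> R (f i) (f (Suc i))"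
    and "\<And>i. i \<le> m \<Longrightarrow> f i \<noteq> u \<and> f i \<noteq> v"
  shows "\<exists>i\<le>m. R u (f i) \<and> R v (f i)"
proof -
  have s: "R x y \<longleftrightarrow> R y x" for x y using assms(2) by (auto dest: sympD)
  obtain g n where g: "g ` {..n} \<subseteq> f ` {..m}" "g 0 \<in> {x. R u x}" "g n \<in> {x. R v x}"
    "\<And>i. i < n \<Longrightarrow> R (g i) (g (Suc i))"
    "\<And>i. i \<le> n \<Longrightarrow> g i \<in> {x. R u x} \<Longrightarrow> i = 0"
    "\<And>i. i \<le> n \<Longrightarrow> g i \<in> {x. R v x} \<Longrightarrow> i = n"
    "\<And>i j. i < j \<Longrightarrow> j \<le> n \<Longrightarrow> R (g i) (g j) \<Longrightarrow> j = Suc i"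
    "\<And>i j. i < j \<Longrightarrow> j \<le> n \<Longrightarrow> g i \<noteq> g j"
    using shortest_walk[of f "{x. R u x}" m "{x. R v x}" R] assms by auto
  have guv: "g i \<noteq> u \<and> g i \<noteq> v" if "i \<le> n" for i
  proof -
    obtain j where "j \<le> m" "g i = f j" using g(1) \<open>i \<le> n\<close> by blast
    then show ?thesis using assms(8) by auto
  qed
  have "n = 0"
  proof (rule ccontr)
    assume n: "n \<noteq> 0"
    \<comment> \<open>The cycle \<open>u\<close>, \<open>g 0\<close>, ..., \<open>g n\<close>,
      \<open>v\<close> has \<open>n + 3\<close> vertices and is a hole as soon as
      \<open>n > 0\<close>.\<close>
    define h where "h i = (if i = 0 then u else if i \<le> Suc n then g (i - 1) else v)" for i
    have "induced_cycle R (n + 3) h"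
    proof (rule induced_cycleI)
      fix i j assume ij: "i < j" "j < n + 3"
      have uv: "u \<noteq> v" using assms(3,4) by (auto dest: irreflpD)
      consider "i = 0" "j = n + 2" | "i = 0" "0 < j" "j \<le> Suc n" | "0 < i" "j \<le> Suc n"
        | "0 < i" "i \<le> Suc n" "j = n + 2" using ij by linarith
      then have "h i \<noteq> h j \<and> (R (h i) (h j) \<longleftrightarrow> j = Suc i \<or> i = 0 \<and> Suc j = n + 3)"
      proof cases
        case 1 then show ?thesis using assms(4) n uv by (simp add: h_def)
      next
        case 2
        then obtain t where t: "j = Suc t" "t \<le> n" by (cases j) auto
        have "R u (g t) \<longleftrightarrow> t = 0" using g(2) g(5)[of t] t by auto
        then show ?thesis using 2 t guv[of t] by (auto simp: h_def)
      next
        case 3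
        then obtain p t where t: "i = Suc p" "j = Suc t" "p < t" "t \<le> n"
          using ij by (cases i; cases j) auto
        have "R (g p) (g t) \<longleftrightarrow> t = Suc p" using g(4)[of p] g(7)[of p t] t by auto
        then show ?thesis using t g(8)[of p t] by (auto simp: h_def)
      next
        case 4
        then obtain t where t: "i = Suc t" "t \<le> n" by (cases i) auto
        have "R (g t) v \<longleftrightarrow> t = n" using g(3) g(6)[of t] t s[of v] by auto
        then show ?thesis using 4 t guv[of t] by (auto simp: h_def)
      qed
      then show "h i \<noteq> h j" "R (h i) (h j) \<longleftrightarrow> j = Suc i \<or> i = 0 \<and> Suc j = n + 3" by auto
    qed (use assms in auto)
    moreover have "n + 3 > 3" using n by simp
    ultimately show False using assms(1) unfolding hole_free_def by blast
  qed
  moreover obtain j where "j \<le> m" "g 0 = f j" using g(1) by blast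
  ultimately show ?thesis using g(2,3) by auto
qed

definition clique_in :: "('a \<Rightarrow> 'a \<Rightarrow> bool) \<Rightarrow> 'a set \<Rightarrow> bool" where
  "clique_in R K \<longleftrightarrow> (\<forall>x\<in>K. \<forall>y\<in>K. x \<noteq> y \<longrightarrow> R x y)"

lemma clique_in_insert:
  "clique_in R (insert x K) \<longleftrightarrow> clique_in R K \<and> (\<forall>y\<in>K. y \<noteq> x \<longrightarrow> R x y \<and> R y x)"
  by (auto simp: clique_in_def)

text \<open>\<open>s\<close> is the second vertex of a shortest path from \<open>x\<close> to
  \<open>y\<close> outside \<open>C\<close>. For each \<open>c\<close> in \<open>C\<close>, the rest
  of that path leads from a neighbour of \<open>x\<close> to the neighbour \<open>y\<close> of
  \<open>c\<close>, so one of its vertices is adjacent to both \<open>x\<close> and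
  \<open>c\<close>; shortness leaves only the second vertex, the same for every
  \<open>c\<close>.\<close>

lemma hole_free_extend_clique:
  assumes hf: "hole_free R" and sy: "symp R" and ir: "irreflp R"
    and C: "clique_in R C" and xy: "x \<noteq> y" "\<And>c. c \<in> C \<Longrightarrow> R x c" "\<And>c. c \<in> C \<Longrightarrow> R y c"
    and walk: "(\<lambda>a b. R a b \<and> a \<notin> C \<and> b \<notin> C)\<^sup>*\<^sup>* x y"
  obtains s where "s \<notin> C" "s \<noteq> x" "clique_in R (insert s (insert x C))"
proof -
  have s: "R x y \<longleftrightarrow> R y x" for x y using sy by (auto dest: sympD)
  have xC: "x \<notin> C" "y \<notin> C" using ir xy by (auto dest: irreflpD)
  let ?R = "\<lambda>a b. R a b \<and> a \<notin> C \<and> b \<notin> C"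
  obtain m f where f: "f 0 = x" "f m = y" "\<And>i. i < m \<Longrightarrow> ?R (f i) (f (Suc i))"
    using rtranclp_imp_relpowp[OF walk] unfolding relpowp_fun_conv by blast
  have "f 0 \<in> {x}" "f m \<in> {y}" using f by auto
  then show thesis
  proof (rule shortest_walk[of f "{x}" m "{y}" ?R, OF _ _ f(3)])
    fix g n
    assume g_ends: "g 0 \<in> {x}" "g n \<in> {y}"
      and g_step: "\<And>i. i < n \<Longrightarrow> ?R (g i) (g (Suc i))"
      and g_short: "\<And>i j. i < j \<Longrightarrow> j \<le> n \<Longrightarrow> ?R (g i) (g j) \<Longrightarrow> j = Suc i"
      and g_inj: "\<And>i j. i < j \<Longrightarrow> j \<le> n \<Longrightarrow> g i \<noteq> g j"
    have "g 0 = x" "g n = y" using g_ends by auto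
    note g = this g_step g_short g_inj
    obtain k where k: "n = Suc k" using g xy by (cases n) auto
    have gC: "g i \<notin> C" if "i \<le> n" for i
      using g(3)[of i] xC(2) g(2) that by (cases "i = n") auto
    have "R (g 1) c" if c: "c \<in> C" for c
    proof -
      have "\<exists>i\<le>k. R x (g (Suc i)) \<and> R c (g (Suc i))"
      proof (rule hole_free_walk_triangle[OF hf sy ir])
        show "R x c" "R c (g (Suc k))" using xy c g k s[of c y] by auto
        show "R x (g (Suc 0))" using g(3)[of 0] g(1) k by auto
        show "R (g (Suc i)) (g (Suc (Suc i)))" if "i < k" for i using g(3)[of "Suc i"] k that by auto
        show "g (Suc i) \<noteq> x \<and> g (Suc i) \<noteq> c" if "i \<le> k" for i
          using g(5)[of 0 "Suc i"] g(1) k that gC[of "Suc i"] c by auto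
      qed
      then obtain i where i: "i \<le> k" "R x (g (Suc i))" "R c (g (Suc i))" by blast
      then have "i = 0" using g(4)[of 0 "Suc i"] gC[of "Suc i"] xC g(1) k by auto
      then show ?thesis using i s by simp
    qed
    then have "clique_in R (insert (g 1) (insert x C))"
      using C xy(2) g(3)[of 0] g(1) k s unfolding clique_in_def by auto
    moreover have "g 1 \<notin> C" "g 1 \<noteq> x" using gC[of 1] g(5)[of 0 1] g(1) k by auto
    ultimately show thesis using that by blast
  qed
qed

section \<open>MAT-labelings\<close>

text \<open>The combinatorial form of an MAT-partition: \<open>L u v\<close> is the 0-based index of the block containing
  the edge, and (MP1), (MP2), (MP3) become the last three assumptions.\<close>

locale mat_labeling =
  fixes E :: "'a::finite \<Rightarrow> 'a \<Rightarrow> bool" and L :: "'a \<Rightarrow> 'a \<Rightarrow> nat"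
  assumes E_sym: "symp E" and E_irrefl: "irreflp E" and L_commute: "L u v = L v u"
    and label_acyclic:
      "E u v \<Longrightarrow> \<not> (\<lambda>a b. E a b \<and> L a b = L u v \<and> {a, b} \<noteq> {u, v})\<^sup>*\<^sup>* u v"
    and label_closed: "E u v \<Longrightarrow> L u v < k \<Longrightarrow> \<not> (\<lambda>a b. E a b \<and> L a b = k)\<^sup>*\<^sup>* u v"
    and card_triangles:
      "E u v \<Longrightarrow> card {w. E u w \<and> E v w \<and> L u w < L u v \<and> L v w < L u v} = L u v"
begin

definition below :: "nat \<Rightarrow> 'a \<Rightarrow> 'a \<Rightarrow> bool" where
  "below k a b \<longleftrightarrow> E a b \<and> L a b < k"

definition apexes :: "'a \<Rightarrow> 'a \<Rightarrow> 'a set" where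
  "apexes u v = {w. E u w \<and> E v w \<and> L u w < L u v \<and> L v w < L u v}"

lemma E_commute: "E a b \<longleftrightarrow> E b a"
  using E_sym by (auto dest: sympD)

lemma not_E_self [simp]: "\<not> E a a"
  using E_irrefl by (auto dest: irreflpD)

lemma below_commute: "below k a b \<longleftrightarrow> below k b a"
  using E_commute L_commute by (auto simp: below_def)

lemma below_sym: "symp (below k)" and below_irrefl: "irreflp (below k)"
  using below_commute by (auto simp: below_def intro: sympI irreflpI)

lemma apexes_eq: "apexes u v = {w. below (L u v) u w \<and> below (L u v) v w}"
  by (auto simp: apexes_def below_def)

lemma apexes_commute: "apexes u v = apexes v u"
  using L_commute by (auto simp: apexes_eq)

lemma card_apexes: "E u v \<Longrightarrow> card (apexes u v) = L u v"
  using card_triangles by (simp add: apexes_def)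

section \<open>Largest labels in cliques\<close>

lemma no_adjacent_top_labels:
  assumes "E a b" "E b c" "E a c" "L a b = k" "L b c = k" "L a c \<le> k"
  shows False
proof (cases "L a c = k")
  case True
  let ?R = "\<lambda>x y. E x y \<and> L x y = L a c \<and> {x, y} \<noteq> {a, c}"
  have "a \<noteq> b" "b \<noteq> c" "a \<noteq> c" using assms by auto
  then have "?R a b" "?R b c" using assms True by (auto simp: doubleton_eq_iff)
  then have "?R\<^sup>*\<^sup>* a c" by (rule rtranclp_two_steps[of ?R])
  then show ?thesis using label_acyclic[OF assms(3)] by blast
next
  case False
  let ?R = "\<lambda>x y. E x y \<and> L x y = k"
  have "?R a b" "?R b c" using assms by auto
  then have "?R\<^sup>*\<^sup>* a c" by (rule rtranclp_two_steps[of ?R])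
  then show ?thesis using label_closed[OF assms(3), of k] False assms(6) by auto
qed

text \<open>Two edges of label \<open>k\<close> with a common vertex are excluded by
  \<open>no_adjacent_top_labels\<close>. Two disjoint ones would be joined by four edges of smaller
  label, a 4-cycle of \<open>below k\<close> whose two possible chords both carry label
  \<open>k\<close>. Hole-freeness of \<open>below k\<close> is an assumption here because the
  induction on \<open>k\<close> uses the lemma before it is known in general.\<close>

lemma top_label_unique_aux:
  assumes "hole_free (below k)" and K: "clique_in (below (Suc k)) K"
    and abcd: "a \<in> K" "b \<in> K" "c \<in> K" "d \<in> K" "a \<noteq> b" "c \<noteq> d" "L a b = k" "L c d = k"
  shows "{a, b} = {c, d}"
proof (rule ccontr)
  assume ne: "{a, b} \<noteq> {c, d}"
  have K': "E x y" "L x y \<le> k" if "x \<in> K" "y \<in> K" "x \<noteq> y" for x y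
    using K that by (auto simp: clique_in_def below_def less_Suc_eq_le)
  have noadj: "\<not> (L x y = k \<and> L y z = k)" if "x \<in> K" "y \<in> K" "z \<in> K" "x \<noteq> y" "y \<noteq> z" "x \<noteq> z" for x y z
    using no_adjacent_top_labels[of x y z k] K' that by auto
  have dist: "a \<noteq> c" "a \<noteq> d" "b \<noteq> c" "b \<noteq> d"
    using noadj[of b a d] noadj[of b a c] noadj[of a b d] noadj[of a b c] abcd ne
      L_commute[of b a] L_commute[of d c] by (auto simp: doubleton_eq_iff)
  have lt: "L x y \<noteq> k" if "x \<in> {a, b}" "y \<in> {c, d}" for x y
    using noadj[of b a y] noadj[of a b y] abcd dist that L_commute[of b a] by auto
  have B: "below k x y" if "x \<in> {a, b}" "y \<in> {c, d}" for x y
    using lt[OF that] K'[of x y] that abcd dist by (auto simp: below_def)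
  have "below k a b \<or> below k c d"
    using hole_free_four_cycle[OF assms(1) below_sym below_irrefl, of a c b d] abcd B
      below_commute[of k c b] below_commute[of k d a] by auto
  then show False using abcd by (auto simp: below_def)
qed

text \<open>Two apexes are opposite vertices of a 4-cycle through \<open>u\<close> and
  \<open>v\<close>. The edge between \<open>u\<close> and \<open>v\<close> is not in
  \<open>below (L u v)\<close>, so the other chord is present.\<close>

lemma clique_apexes_aux:
  assumes "hole_free (below (L u v))" "E u v"
  shows "clique_in (below (L u v)) (apexes u v)"
  unfolding clique_in_def
proof (intro ballI impI)
  fix x y assume xy: "x \<in> apexes u v" "y \<in> apexes u v" "x \<noteq> y"
  have "u \<noteq> v" using assms(2) by auto
  then have "below (L u v) u v \<or> below (L u v) x y"
    using hole_free_four_cycle[OF assms(1) below_sym below_irrefl, of u x v y] xy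
      below_commute[of "L u v"] by (auto simp: apexes_eq)
  then show "below (L u v) x y" by (auto simp: below_def)
qed

text \<open>A hole of \<open>below (Suc k)\<close> contains an edge of label \<open>k\<close>, whose
  \<open>k\<close> apexes form a clique \<open>C\<close>. The aim is to show that all edges of the
  hole have label \<open>k\<close>, which contradicts \<open>label_acyclic\<close>.\<close>

lemma hole_free_below_step:
  assumes hf: "hole_free (below k)"
    and bound: "\<And>K. clique_in (below k) K \<Longrightarrow> card K \<le> Suc k"
  shows "hole_free (below (Suc k))"
  unfolding hole_free_def
proof (intro notI, elim exE conjE)
  fix n f0 assume n: "n > 3" and f0: "induced_cycle (below (Suc k)) n f0"
  have "\<exists>r<n. L (f0 r) (f0 ((r + 1) mod n)) = k"
  proof (rule ccontr)
    assume no: "\<not> ?thesis"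
    have "induced_cycle (below k) n f0"
      unfolding induced_cycle_def
    proof (intro conjI allI impI)
      show "inj_on f0 {..<n}" using f0 by (simp add: induced_cycle_def)
      fix i j assume ij: "i < n" "j < n"
      have "below (Suc k) (f0 i) (f0 j) \<longleftrightarrow> j = (i + 1) mod n \<or> i = (j + 1) mod n"
        using f0 ij by (auto simp: induced_cycle_def)
      moreover have "L (f0 i) (f0 j) \<noteq> k" if "j = (i + 1) mod n \<or> i = (j + 1) mod n"
        using that no ij L_commute[of "f0 i" "f0 j"] by auto
      ultimately show "below k (f0 i) (f0 j) \<longleftrightarrow> j = (i + 1) mod n \<or> i = (j + 1) mod n"
        by (auto simp: below_def less_Suc_eq)
    qed
    then show False using hf n unfolding hole_free_def by blast
  qed
  then obtain r where r: "r < n" "L (f0 r) (f0 ((r + 1) mod n)) = k" by blast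
  \<comment> \<open>Rotation by \<open>r + 1\<close> turns the chosen edge of label \<open>k\<close>
    into the closing edge from \<open>f (n - 1)\<close> to \<open>f 0\<close>.\<close>
  define f where "f i = f0 ((i + (r + 1)) mod n)" for i
  have f_wrap: "f (n - 1) = f0 r" "f 0 = f0 ((r + 1) mod n)"
    using n r by (auto simp: f_def)
  have inj: "f i \<noteq> f j" if "i < n" "j < n" "i \<noteq> j" for i j
    using f0 n that shift_mod_eq_iff[of i n j "r + 1"]
    by (auto simp: f_def induced_cycle_def inj_on_def)
  have adj: "below (Suc k) (f i) (f j) \<longleftrightarrow> j = (i + 1) mod n \<or> i = (j + 1) mod n"
    if ij: "i < n" "j < n" for i j
  proof -
    let ?s = "\<lambda>i. (i + (r + 1)) mod n"
    have "below (Suc k) (f i) (f j) \<longleftrightarrow> ?s j = (?s i + 1) mod n \<or> ?s i = (?s j + 1) mod n"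
      using f0 n unfolding f_def induced_cycle_def by simp
    also have "\<dots> \<longleftrightarrow> j = (i + 1) mod n \<or> i = (j + 1) mod n"
      unfolding shift_mod_Suc using ij n shift_mod_eq_iff[of _ n _ "r + 1"]
      by (metis less_nat_zero_code mod_less_divisor neq0_conv)
    finally show ?thesis .
  qed
  define C where "C = apexes (f (n - 1)) (f 0)"
  \<comment> \<open>Edges that are not good can be bypassed outside \<open>C\<close>, and a component outside \<open>C\<close>
    has at most one vertex complete to \<open>C\<close>; so one good edge forces all edges to be good.\<close>
  define good where "good i \<longleftrightarrow> L (f i) (f ((i + 1) mod n)) = k \<and> apexes (f i) (f ((i + 1) mod n)) = C"
    for i
  have good_last: "good (n - 1)"
    using n r f_wrap by (auto simp: good_def C_def)
  have next_adj: "below (Suc k) (f i) (f ((i + 1) mod n))" if "i < n" for i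
    using adj[of i "(i + 1) mod n"] that n by auto
  have C_adj: "below k (f i) c" "below k (f ((i + 1) mod n)) c" if "good i" "c \<in> C" for i c
    using that by (auto simp: good_def apexes_eq)
  have C_clique: "clique_in (below k) C" and C_card: "card C = k"
    using clique_apexes_aux[of "f (n - 1)" "f 0"] card_apexes[of "f (n - 1)" "f 0"]
      next_adj[of "n - 1"] good_last hf n by (auto simp: good_def C_def below_def)
  \<comment> \<open>A vertex of \<open>C\<close> is adjacent to both ends of the closing edge, which
    is impossible for a vertex of an induced cycle of length above 3.\<close>
  have f_C: "f i \<notin> C" if "i < n" for i
  proof
    assume "f i \<in> C"
    then have "below (Suc k) (f (n - 1)) (f i)" "below (Suc k) (f 0) (f i)"
      using C_adj[OF good_last] n by (auto simp: below_def less_Suc_eq)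
    then show False
      using adj[of "n - 1" i] adj[of 0 i] that n by (auto simp: mod_Suc split: if_splits)
  qed
  let ?R = "\<lambda>a b. below k a b \<and> a \<notin> C \<and> b \<notin> C"
  \<comment> \<open>An edge of smaller label is itself a step. An edge of label \<open>k\<close>
    with a different apex set has an apex outside \<open>C\<close>, since both sets have
    \<open>k\<close> elements, and the detour through it uses smaller labels.\<close>
  have bad_step: "?R\<^sup>*\<^sup>* (f i) (f (Suc i))" if "\<not> good i" "Suc i < n" for i
  proof (cases "L (f i) (f (Suc i)) = k")
    case True
    let ?C = "apexes (f i) (f (Suc i))"
    have "?C \<noteq> C" using True that by (auto simp: good_def)
    moreover have "card ?C = k" using next_adj[of i] True card_apexes that by (auto simp: below_def)
    ultimately obtain c where c: "c \<in> ?C" "c \<notin> C"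
      using C_card card_subset_eq[of C ?C] by auto
    then have "?R (f i) c" "?R c (f (Suc i))"
      using that f_C[of i] f_C[of "Suc i"] True below_commute by (auto simp: apexes_eq)
    then show ?thesis by (rule rtranclp_two_steps[of ?R])
  next
    case False
    then have "?R (f i) (f (Suc i))"
      using next_adj[of i] f_C[of i] f_C[of "Suc i"] that by (auto simp: below_def)
    then show ?thesis by blast
  qed
  have all_good: "good i" if "i < n" for i
  proof (rule ccontr)
    assume "\<not> good i"
    then obtain a where a: "\<not> good a" "\<And>b. b < a \<Longrightarrow> good b"
      using exists_least_iff[of "\<lambda>i. \<not> good i"] by blast
    have "a \<le> i" using a(2)[of i] \<open>\<not> good i\<close> by (meson not_less)
    moreover have "a \<noteq> n - 1" using good_last a(1) by metis
    ultimately have an: "a < n - 1" using that by linarith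
    have "\<exists>b. a < b \<and> b < n \<and> good b" using an good_last by (intro exI[of _ "n - 1"]) auto
    then obtain b where b: "a < b" "b < n" "good b" "\<And>c. c < b \<Longrightarrow> \<not> (a < c \<and> c < n \<and> good c)"
      using exists_least_iff[of "\<lambda>b. a < b \<and> b < n \<and> good b"] by blast
    have walk: "?R\<^sup>*\<^sup>* (f a) (f c)" if "a \<le> c" "c \<le> b" for c
      using that
    proof (induction c rule: dec_induct)
      case base show ?case by simp
    next
      case (step c)
      then have "\<not> good c" using a(1) b(2) b(4)[of c] by (cases "c = a") auto
      then show ?case using bad_step[of c] step b(2) by (auto intro: rtranclp_trans)
    qed
    \<comment> \<open>The edge before \<open>a\<close> is good (the closing edge if
      \<open>a = 0\<close>), hence \<open>f a\<close> is complete to \<open>C\<close>.\<close>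
    have fa: "below k (f a) c" if "c \<in> C" for c
    proof (cases a)
      case 0 then show ?thesis using C_adj(2)[OF good_last that] n by simp
    next
      case (Suc a') then show ?thesis using C_adj(2)[OF a(2)[of a'] that] an by simp
    qed
    obtain s where s: "s \<notin> C" "s \<noteq> f a" "clique_in (below k) (insert s (insert (f a) C))"
      using hole_free_extend_clique[OF hf below_sym below_irrefl C_clique, of "f a" "f b"]
        inj[of a b] fa C_adj(1)[OF b(3)] walk[of b] b by auto
    \<comment> \<open>One vertex more than \<open>bound\<close> allows in
      \<open>below k\<close>.\<close>
    have "card (insert s (insert (f a) C)) = Suc (Suc k)"
      using s f_C[of a] an C_card by auto
    then show False using bound[OF s(3)] by simp
  qed
  let ?R = "\<lambda>a b. E a b \<and> L a b = L (f 0) (f (n - 1)) \<and> {a, b} \<noteq> {f 0, f (n - 1)}"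
  have lab: "L (f 0) (f (n - 1)) = k" using good_last n L_commute[of "f 0"] by (auto simp: good_def)
  have "?R\<^sup>*\<^sup>* (f 0) (f i)" if "i \<le> n - 1" for i
    using that
  proof (induction i)
    case (Suc i)
    have "i < n" "Suc i < n" using Suc.prems n by linarith+
    then have "i = 0 \<or> f i \<noteq> f 0" "Suc i = n - 1 \<or> f (Suc i) \<noteq> f (n - 1)" "f (Suc i) \<noteq> f 0"
      using inj[of i 0] inj[of "Suc i" "n - 1"] inj[of "Suc i" 0] n by auto
    moreover have "\<not> (i = 0 \<and> Suc i = n - 1)" using n by auto
    ultimately have "{f i, f (Suc i)} \<noteq> {f 0, f (n - 1)}" by (auto simp: doubleton_eq_iff)
    then have "?R (f i) (f (Suc i))"
      using next_adj[of i] all_good[of i] Suc.prems n lab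
      by (auto simp: good_def below_def)
    then show ?case using Suc by (auto intro: rtranclp.rtrancl_into_rtrancl)
  qed simp
  moreover have "E (f 0) (f (n - 1))"
    using next_adj[of "n - 1"] n E_commute by (auto simp: below_def)
  ultimately show False using label_acyclic by blast
qed

text \<open>The step for holes uses the clique bound at \<open>k\<close>. The step for cliques uses
  hole-freeness at \<open>k\<close>: it makes the edge of label \<open>k\<close> in a clique unique,
  so that deleting one end of it leaves a clique of \<open>below k\<close>.\<close>

lemma below_hole_free_and_clique_bound:
  "hole_free (below k) \<and> (\<forall>K. clique_in (below k) K \<longrightarrow> card K \<le> Suc k)"
proof (induction k)
  case 0
  have "hole_free (below 0)"
    unfolding hole_free_def
  proof (intro notI, elim exE conjE)
    fix n f assume "n > 3" and f: "induced_cycle (below 0) n f"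
    then have "below 0 (f 0) (f 1) \<longleftrightarrow> 1 = (0 + 1) mod n \<or> 0 = (1 + 1) mod n"
      unfolding induced_cycle_def by (metis less_trans one_less_numeral_iff semiring_norm(77) zero_less_numeral)
    then show False using \<open>n > 3\<close> by (auto simp: below_def)
  qed
  moreover have "card K \<le> Suc 0" if "clique_in (below 0) K" for K
    using that by (subst card_le_Suc0_iff_eq) (auto simp: clique_in_def below_def)
  ultimately show ?case by blast
next
  case (Suc k)
  then have hf: "hole_free (below k)" and bound: "\<And>K. clique_in (below k) K \<Longrightarrow> card K \<le> Suc k"
    by auto
  have "card K \<le> Suc (Suc k)" if K: "clique_in (below (Suc k)) K" for K
  proof (cases "clique_in (below k) K")
    case True then show ?thesis using bound[of K] by simp
  next
    case False
    then obtain a b where ab: "a \<in> K" "b \<in> K" "a \<noteq> b" "L a b = k"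
      using K by (fastforce simp: clique_in_def below_def less_Suc_eq)
    have "clique_in (below k) (K - {a})"
      unfolding clique_in_def
    proof (intro ballI impI)
      fix x y assume xy: "x \<in> K - {a}" "y \<in> K - {a}" "x \<noteq> y"
      then have "L x y \<noteq> k" using top_label_unique_aux[OF hf K ab(1,2), of x y] ab by auto
      then show "below k x y" using K xy by (auto simp: clique_in_def below_def less_Suc_eq)
    qed
    then have "card (K - {a}) \<le> Suc k" by (rule bound)
    then show ?thesis using ab by (simp add: card_Diff_singleton)
  qed
  then show ?case using hole_free_below_step[OF hf bound] by blast
qed

lemmas hole_free_below = below_hole_free_and_clique_bound[THEN conjunct1]

lemma card_clique_below: "clique_in (below k) K \<Longrightarrow> card K \<le> Suc k"
  using below_hole_free_and_clique_bound by blast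

lemmas top_label_unique = top_label_unique_aux[OF hole_free_below]
lemmas clique_apexes = clique_apexes_aux[OF hole_free_below]

lemma hole_free_E: "hole_free E"
proof -
  have "L a b < Suc (Max (range (\<lambda>(a, b). L a b)))" for a b
    by (auto simp: less_Suc_eq_le intro!: Max_ge)
  then have "E = below (Suc (Max (range (\<lambda>(a, b). L a b))))"
    by (auto simp: below_def fun_eq_iff)
  then show ?thesis using hole_free_below by metis
qed

text \<open>By the bound on cliques of \<open>below m\<close>, the cliques \<open>Q\<close> considered here are the largest possible.\<close>

lemma apexes_in_full_clique:
  assumes "clique_in (below m) Q" "card Q = Suc m" "x \<in> Q" "y \<in> Q" "x \<noteq> y"
  shows "apexes x y \<subseteq> Q"
  using assms
proof (induction m arbitrary: Q)
  case 0
  then show ?case by (auto simp: clique_in_def below_def)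
next
  case (Suc m)
  note Q = Suc.prems(1,2)
  have "\<not> clique_in (below m) Q" using card_clique_below[of m Q] Q by auto
  then obtain a b where ab: "a \<in> Q" "b \<in> Q" "a \<noteq> b" "L a b = m"
    using Q by (fastforce simp: clique_in_def below_def less_Suc_eq)
  have low: "below m p q" if "p \<in> Q" "q \<in> Q" "p \<noteq> q" "{p, q} \<noteq> {a, b}" for p q
    using top_label_unique[OF Q(1) ab(1,2), of p q] ab Q(1) that
    by (auto simp: clique_in_def below_def less_Suc_eq)
  have sub: "clique_in (below m) (Q - {c})" "card (Q - {c}) = Suc m" if "c \<in> {a, b}" for c
    using low that Q(2) ab by (auto simp: clique_in_def card_Diff_singleton doubleton_eq_iff)
  show ?case
  proof (cases "{x, y} = {a, b}")
    case True
    \<comment> \<open>The \<open>m\<close> vertices of \<open>Q\<close> other than \<open>a\<close>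
      and \<open>b\<close> are apexes of the top edge, and an edge of label \<open>m\<close> has no
      more than \<open>m\<close> of them.\<close>
    have "Q - {a, b} \<subseteq> apexes a b" using low ab by (auto simp: apexes_eq doubleton_eq_iff)
    moreover have "card (Q - {a, b}) = m" using Q(2) ab by (simp add: card_Diff_subset)
    moreover have "card (apexes a b) = m"
      using card_apexes[of a b] ab Q(1) by (auto simp: clique_in_def below_def)
    ultimately have "Q - {a, b} = apexes a b" by (intro card_subset_eq) auto
    then show ?thesis using True apexes_commute[of x y] by (auto simp: doubleton_eq_iff)
  next
    case False
    then have "\<exists>c\<in>{a, b}. x \<noteq> c \<and> y \<noteq> c" using Suc.prems(5) ab(3) by auto
    then obtain c where "c \<in> {a, b}" "x \<noteq> c" "y \<noteq> c" by blast
    then show ?thesis using Suc.IH[OF sub[of c]] Suc.prems by auto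
  qed
qed

text \<open>The cases concern the largest label in the triangle \<open>u\<close>, \<open>v\<close>,
  \<open>w\<close>. If only the edge between \<open>u\<close> and \<open>v\<close> has it,
  \<open>w\<close> is an apex too, and apexes form a clique. Otherwise an edge at \<open>w\<close>,
  say to \<open>u\<close>, has the largest label \<open>m\<close>, and has it alone, so
  \<open>v\<close> is an apex of it. Then \<open>u\<close> and the apexes of \<open>w\<close> and
  \<open>u\<close> form a clique of the maximal size \<open>m + 1\<close> in \<open>below m\<close>,
  which absorbs \<open>x\<close> by \<open>apexes_in_full_clique\<close>.\<close>

lemma apexes_adjacent_common_neighbour:
  assumes "E u v" "E w u" "E w v" "x \<in> apexes u v"
  shows "x = w \<or> E x w"
proof -
  have main: "x = w \<or> E x w"
    if uv: "E u v" "E w u" "E w v" "L w v \<le> L w u" "L u v \<le> L w u" "x \<in> apexes u v" for u v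
  proof -
    let ?m = "L w u"
    have ne: "u \<noteq> v" "w \<noteq> u" "w \<noteq> v" using uv by auto
    have tri: "clique_in (below (Suc ?m)) {u, v, w}"
      using uv E_commute L_commute by (auto simp: clique_in_def below_def less_Suc_eq_le)
    have "L w v \<noteq> ?m" "L u v \<noteq> ?m"
    proof -
      have "{w, u} = {w, v}" if "L w v = ?m"
        by (rule top_label_unique[OF tri]) (use that ne in auto)
      moreover have "{w, u} = {u, v}" if "L u v = ?m"
        by (rule top_label_unique[OF tri]) (use that ne in auto)
      ultimately show "L w v \<noteq> ?m" "L u v \<noteq> ?m" using ne by (auto simp: doubleton_eq_iff)
    qed
    then have v: "v \<in> apexes w u" using uv by (auto simp: apexes_def)
    let ?Q = "insert u (apexes w u)"
    have "clique_in (below ?m) ?Q"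
      using clique_apexes[OF uv(2)] below_commute[of ?m u]
      by (auto simp: clique_in_insert apexes_eq)
    moreover have "card ?Q = Suc ?m"
      using card_apexes[OF uv(2)] by (subst card_insert_disjoint) (auto simp: apexes_def)
    ultimately have "x \<in> ?Q" using apexes_in_full_clique[of ?m ?Q u v] v ne uv(6) by auto
    then show ?thesis using uv(2) E_commute by (auto simp: apexes_def)
  qed
  consider "w \<in> apexes u v" | "L w v \<le> L w u" "L u v \<le> L w u" | "L w u \<le> L w v" "L v u \<le> L w v"
    using assms E_commute[of w] L_commute[of w] L_commute[of u v] by (fastforce simp: apexes_def)
  then show ?thesis
  proof cases
    case 1 then show ?thesis
      using clique_apexes[OF assms(1)] assms(4) by (auto simp: clique_in_def below_def)
  next
    case 2 then show ?thesis using main[of u v] assms by auto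
  next
    case 3 then show ?thesis using main[of v u] assms E_commute apexes_commute by auto
  qed
qed

text \<open>Only rim edges are known to have labels at most \<open>?k\<close>. The triangle is
  therefore found by walking along the rim: the other rim edges connect the ends of the chosen one,
  and \<open>hole_free_walk_triangle\<close> in \<open>below (Suc ?k)\<close> yields a vertex joined
  to both ends by labels at most \<open>?k\<close>.\<close>

lemma no_sun:
  fixes n :: nat
  assumes n: "n \<ge> 3"
    and clique: "\<And>i j. i < n \<Longrightarrow> j < n \<Longrightarrow> i \<noteq> j \<Longrightarrow> E (u i) (u j)"
    and w: "\<And>i j. i < n \<Longrightarrow> j < n \<Longrightarrow> E (w i) (u j) \<longleftrightarrow> j = i \<or> j = (i + 1) mod n"
    and distinct: "\<And>i j. i < n \<Longrightarrow> j < n \<Longrightarrow> w i \<noteq> u j"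
  shows False
proof -
  let ?l = "\<lambda>i. L (u i) (u ((i + 1) mod n))"
  have "\<exists>i\<in>{..<n}. \<forall>j\<in>{..<n}. ?l j \<le> ?l i"
  proof -
    have "Max (?l ` {..<n}) \<in> ?l ` {..<n}" using n by (intro Max_in) (auto simp: lessThan_empty_iff)
    then obtain i where i: "Max (?l ` {..<n}) = ?l i" "i \<in> {..<n}" by (rule imageE)
    have "?l j \<le> Max (?l ` {..<n})" if "j \<in> {..<n}" for j using that by (intro Max_ge) auto
    then show ?thesis unfolding i(1) using i(2) by blast
  qed
  then obtain i where i: "i < n" "\<And>j. j < n \<Longrightarrow> ?l j \<le> ?l i" by auto
  \<comment> \<open>The rotation \<open>?s\<close> puts the chosen edge at positions 0 and 1; the
    walk visits positions 2 to \<open>n - 1\<close>, hence has length \<open>n - 3\<close>.\<close>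
  let ?s = "\<lambda>t. (t + i) mod n" and ?k = "?l i"
  have s_eq: "?s a = ?s b \<longleftrightarrow> a = b" if "a < n" "b < n" for a b
    using shift_mod_eq_iff that .
  have s01: "?s 0 = i" "?s 1 = (i + 1) mod n" using i by auto
  have s_lt: "?s t < n" for t using n by auto
  have ne: "u a \<noteq> u b" if "a < n" "b < n" "a \<noteq> b" for a b
    using clique[OF that] by auto
  have step: "below (Suc ?k) (u (?s t)) (u (?s (t + 1)))" for t
  proof -
    have eq: "?s (t + 1) = (?s t + 1) mod n" by (simp add: mod_simps)
    have "?s t \<noteq> (?s t + 1) mod n" using n s_lt[of t] by (auto simp: mod_Suc)
    then show ?thesis
      using i(2)[OF s_lt[of t]] clique[of "?s t" "?s (t + 1)"] s_lt n unfolding eq below_def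
      by (auto simp: less_Suc_eq_le)
  qed
  have "\<exists>t\<le>n - 3. below (Suc ?k) (u (?s 1)) (u (?s (t + 2))) \<and> below (Suc ?k) (u (?s 0)) (u (?s (t + 2)))"
  proof (rule hole_free_walk_triangle[OF hole_free_below below_sym below_irrefl])
    show "below (Suc ?k) (u (?s 1)) (u (?s 0))" using step[of 0] below_commute by simp
    show "below (Suc ?k) (u (?s 1)) (u (?s (0 + 2)))" using step[of 1] by (simp add: numeral_2_eq_2)
    have "n - 3 + 2 + 1 = n" using n by simp
    then have "?s (n - 3 + 2 + 1) = ?s 0" by (simp only: mod_add_self1 add_0)
    then show "below (Suc ?k) (u (?s 0)) (u (?s (n - 3 + 2)))"
      using step[of "n - 3 + 2"] below_commute by metis
    show "below (Suc ?k) (u (?s (t + 2))) (u (?s (Suc t + 2)))" for t using step[of "t + 2"] by simp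
    show "u (?s (t + 2)) \<noteq> u (?s 1) \<and> u (?s (t + 2)) \<noteq> u (?s 0)" if "t \<le> n - 3" for t
      using ne[OF s_lt s_lt, of "t + 2" 1] ne[OF s_lt s_lt, of "t + 2" 0]
        s_eq[of "t + 2" 1] s_eq[of "t + 2" 0] that n by auto
  qed
  then obtain t where t: "t \<le> n - 3" "below (Suc ?k) (u (?s 1)) (u (?s (t + 2)))"
    "below (Suc ?k) (u (?s 0)) (u (?s (t + 2)))" by blast
  define j where "j = ?s (t + 2)"
  have j: "j < n" "j \<noteq> i" "j \<noteq> (i + 1) mod n"
    using s_eq[of "t + 2" 0] s_eq[of "t + 2" 1] t(1) n s01 s_lt unfolding j_def by auto
  let ?a = "u i" and ?b = "u ((i + 1) mod n)"
  have ab: "below (Suc ?k) ?a ?b" "below (Suc ?k) ?a (u j)" "below (Suc ?k) ?b (u j)"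
    using step[of 0] t(2,3) s01 unfolding j_def by auto
  have tri: "clique_in (below (Suc ?k)) {?a, ?b, u j}"
    using ab below_commute by (auto simp: clique_in_def)
  have neq: "?a \<noteq> ?b" "?a \<noteq> u j" "?b \<noteq> u j" using ab by (auto simp: below_def)
  \<comment> \<open>The largest label of a triangle is unique, so the other two edges have labels
    strictly below \<open>?k\<close>.\<close>
  have "u j \<in> apexes ?a ?b"
    using top_label_unique[OF tri, of ?a ?b ?a "u j"] top_label_unique[OF tri, of ?a ?b ?b "u j"] ab neq
    by (auto simp: apexes_eq below_def doubleton_eq_iff less_Suc_eq)
  then have "u j = w i \<or> E (u j) (w i)"
    using apexes_adjacent_common_neighbour[of ?a ?b "w i" "u j"] ab(1) w[of i i] w[of i "(i + 1) mod n"] i n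
    by (auto simp: below_def)
  then show False using w[of i j] distinct[of i j] j i E_commute by auto
qed

end

section \<open>Nest points of totally balanced families\<close>

text \<open>Instead of forbidding special cycles directly, the condition asks that every walk of members
  closing up through a member \<open>A\<close> has a chord at \<open>A\<close>; this form passes to traces without any
  bookkeeping of cycles.\<close>

definition totally_balanced :: "'a set set \<Rightarrow> bool" where
  "totally_balanced \<F> \<longleftrightarrow>
     (\<forall>A\<in>\<F>. \<forall>a\<in>A. \<forall>b\<in>A. \<forall>f (m::nat).
        (\<forall>i\<le>m. f i \<in> \<F>) \<and> (\<forall>i<m. \<not> f i \<inter> f (Suc i) \<subseteq> A) \<and> a \<in> f 0 \<and> b \<in> f m
        \<longrightarrow> (\<exists>i\<le>m. a \<in> f i \<and> b \<in> f i))"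

lemma totally_balancedD:
  fixes f :: "nat \<Rightarrow> 'a set"
  assumes "totally_balanced \<F>" "A \<in> \<F>" "a \<in> A" "b \<in> A"
    "\<And>i. i \<le> m \<Longrightarrow> f i \<in> \<F>" "\<And>i. i < m \<Longrightarrow> \<not> f i \<inter> f (Suc i) \<subseteq> A" "a \<in> f 0" "b \<in> f m"
  obtains i where "i \<le> m" "a \<in> f i" "b \<in> f i"
proof -
  note assms(1)[unfolded totally_balanced_def, THEN bspec, OF assms(2), THEN bspec, OF assms(3),
    THEN bspec, OF assms(4), THEN spec, of f, THEN spec, of m]
  then have "\<exists>i\<le>m. a \<in> f i \<and> b \<in> f i" using assms(5-8) by simp
  then show thesis using that by blast
qed

text \<open>A walk of traces lifts to a walk of members: a step whose trace is not inside
  \<open>A \<inter> W\<close> is not inside \<open>A\<close>. The chord found upstairs restricts, as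
  \<open>a\<close> and \<open>b\<close> lie in \<open>W\<close>.\<close>

lemma totally_balanced_trace:
  assumes tb: "totally_balanced \<F>" and sub: "\<G> \<subseteq> \<F>"
  shows "totally_balanced ((\<lambda>F. F \<inter> W) ` \<G>)"
  unfolding totally_balanced_def
proof (intro ballI allI impI, elim conjE)
  fix A' a b and f' :: "nat \<Rightarrow> 'a set" and m
  assume A': "A' \<in> (\<lambda>F. F \<inter> W) ` \<G>" and ab: "a \<in> A'" "b \<in> A'"
    and f': "\<forall>i\<le>m. f' i \<in> (\<lambda>F. F \<inter> W) ` \<G>" "\<forall>i<m. \<not> f' i \<inter> f' (Suc i) \<subseteq> A'" "a \<in> f' 0" "b \<in> f' m"
  obtain A where A: "A \<in> \<G>" "A' = A \<inter> W" using A' by blast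
  have "\<forall>i. \<exists>F. i \<le> m \<longrightarrow> F \<in> \<G> \<and> f' i = F \<inter> W" using f'(1) by blast
  then obtain f where f: "\<And>i. i \<le> m \<Longrightarrow> f i \<in> \<G> \<and> f' i = f i \<inter> W" by metis
  have "\<not> f i \<inter> f (Suc i) \<subseteq> A" if "i < m" for i
    using f[of i] f[of "Suc i"] f'(2) that A by auto
  then obtain i where "i \<le> m" "a \<in> f i" "b \<in> f i"
    using totally_balancedD[OF tb, of A a b m f] A ab f f'(3,4) sub by blast
  then show "\<exists>i\<le>m. a \<in> f' i \<and> b \<in> f' i" using f ab A by auto
qed

definition nest_point :: "'a set set \<Rightarrow> 'a \<Rightarrow> bool" where
  "nest_point \<F> v \<longleftrightarrow> (\<forall>F\<in>\<F>. \<forall>F'\<in>\<F>. v \<in> F \<longrightarrow> v \<in> F' \<longrightarrow> F \<subseteq> F' \<or> F' \<subseteq> F)"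

text \<open>Prescribing a member to be avoided makes the induction work. On a smaller ground set
  \<open>W\<close> it returns a point outside \<open>B\<close>, and all members through such a
  point, other than \<open>V\<close>, lie inside \<open>W\<close>, so that the trace on
  \<open>W\<close> does not change them.\<close>

lemma nest_point_outside:
  assumes "finite V" "\<F> \<subseteq> Pow V" "totally_balanced \<F>" "A \<in> \<F>" "A \<noteq> V"
  shows "\<exists>v\<in>V - A. nest_point \<F> v"
  using assms
proof (induction "card V" arbitrary: V \<F> A rule: less_induct)
  case less
  note fin = less.prems(1) and FV = less.prems(2) and tb = less.prems(3)
  define \<G> where "\<G> = \<F> - {V}"
  have "finite \<G>" using fin FV unfolding \<G>_def by (meson finite_Diff finite_Pow_iff rev_finite_subset)
  moreover have "A \<in> \<G>" using less.prems by (simp add: \<G>_def)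
  \<comment> \<open>A nest point outside the larger \<open>B\<close> also lies outside
    \<open>A\<close>; maximality of \<open>B\<close> later ensures
    \<open>W \<noteq> V\<close>.\<close>
  ultimately obtain B where B: "B \<in> \<G>" "A \<subseteq> B" and maxB: "\<And>F. F \<in> \<G> \<Longrightarrow> B \<subseteq> F \<Longrightarrow> F = B"
    using finite_has_maximal2[of \<G> A] by auto
  have "B \<subseteq> V" "B \<noteq> V" using B FV by (auto simp: \<G>_def)
  then obtain d where d: "d \<in> V" "d \<notin> B" by blast
  have "\<exists>v\<in>V - B. nest_point \<F> v"
  proof (cases "\<exists>F\<in>\<G>. d \<in> F")
    case False
    then have "nest_point \<F> d" unfolding nest_point_def \<G>_def by auto
    then show ?thesis using d by blast
  next
    case True
    then obtain F0 where F0: "F0 \<in> \<G>" "d \<in> F0" by blast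
    \<comment> \<open>Members are linked when they meet outside \<open>B\<close>, and
      \<open>comp\<close> is the component of \<open>F0\<close> for this relation.\<close>
    let ?R = "\<lambda>F F'. F \<in> \<G> \<and> F' \<in> \<G> \<and> \<not> F \<inter> F' \<subseteq> B"
    define comp where "comp = {F. ?R\<^sup>*\<^sup>* F0 F}"
    have comp_sub: "F \<in> \<G> \<and> \<not> F \<subseteq> B" if "F \<in> comp" for F
    proof -
      have "?R\<^sup>*\<^sup>* F0 F" using that by (simp add: comp_def)
      then show ?thesis by (induction rule: rtranclp_induct) (use F0 d in auto)
    qed
    have R_sym: "symp ?R" by (auto intro!: sympI)
    have comp_conn: "?R\<^sup>*\<^sup>* F F'" if "F \<in> comp" "F' \<in> comp" for F F'
    proof -
      have "?R\<^sup>*\<^sup>* F F0" using that sympD[OF symp_rtranclp[OF R_sym]] by (auto simp: comp_def)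
      then show ?thesis using that by (auto simp: comp_def)
    qed
    have F0_comp: "F0 \<in> comp" by (simp add: comp_def)
    have "finite comp" using \<open>finite \<G>\<close> comp_sub by (meson finite_subset subsetI)
    let ?c = "\<lambda>F. card (F \<inter> B)"
    have "Max (?c ` comp) \<in> ?c ` comp" using \<open>finite comp\<close> F0_comp by (intro Max_in) auto
    then obtain F1 where F1: "F1 \<in> comp" "?c F1 = Max (?c ` comp)" by auto
    then have F1_max: "?c F \<le> ?c F1" if "F \<in> comp" for F
      using Max_ge[of "?c ` comp" "?c F"] \<open>finite comp\<close> that by simp
    note F1 = F1(1)
    \<comment> \<open>If \<open>a\<close> in \<open>F \<inter> B\<close> is missing from
      \<open>F1\<close>, let \<open>f n\<close> be the first member containing \<open>a\<close> on a
      walk from \<open>F1\<close> to \<open>F\<close>. For each \<open>b\<close> in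
      \<open>F1 \<inter> B\<close>, total balance at \<open>B\<close> gives a member of the walk
      containing both points, which can only be \<open>f n\<close>. So the trace of
      \<open>f n\<close> on \<open>B\<close> would be larger than that of \<open>F1\<close>.\<close>
    have dom: "F \<inter> B \<subseteq> F1" if F: "F \<in> comp" for F
    proof (rule ccontr)
      assume "\<not> F \<inter> B \<subseteq> F1"
      then obtain a where a: "a \<in> F" "a \<in> B" "a \<notin> F1" by blast
      obtain m f where f: "f 0 = F1" "f m = F" "\<And>i. i < m \<Longrightarrow> ?R (f i) (f (Suc i))"
        using rtranclp_imp_relpowp[OF comp_conn[OF F1 F]] unfolding relpowp_fun_conv by blast
      have "\<exists>n. n \<le> m \<and> a \<in> f n" using f(2) a by blast
      then obtain n where n: "n \<le> m" "a \<in> f n" and n_least: "\<And>i. i < n \<Longrightarrow> \<not> (i \<le> m \<and> a \<in> f i)"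
        using exists_least_iff[of "\<lambda>n. n \<le> m \<and> a \<in> f n"] by blast
      have reach: "?R\<^sup>*\<^sup>* F1 (f i)" if "i \<le> m" for i
        using that by (induction i) (auto simp: f(1) intro: rtranclp.rtrancl_into_rtrancl dest!: f(3)[OF Suc_le_lessD])
      have f_comp: "f i \<in> comp" if "i \<le> m" for i
        using reach[OF that] F1 by (auto simp: comp_def)
      have "b \<in> f n" if b: "b \<in> F1 \<inter> B" for b
      proof -
        obtain i where "i \<le> n" "b \<in> f i" "a \<in> f i"
        proof (rule totally_balancedD[OF tb, of B b a n f])
          show "f i \<in> \<F>" if "i \<le> n" for i using comp_sub[OF f_comp[of i]] that n(1) by (simp add: \<G>_def)
          show "\<not> f i \<inter> f (Suc i) \<subseteq> B" if "i < n" for i using f(3)[of i] that n(1) by auto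
        qed (use B a b f(1) n in \<open>auto simp: \<G>_def\<close>)
        then show ?thesis using n_least[of i] n(1) by (cases "i = n") auto
      qed
      then have "insert a (F1 \<inter> B) \<subseteq> f n \<inter> B" using n(2) a by auto
      then have "card (insert a (F1 \<inter> B)) \<le> card (f n \<inter> B)"
        using finite_subset[OF \<open>B \<subseteq> V\<close> fin] by (intro card_mono) auto
      moreover have "card (insert a (F1 \<inter> B)) = Suc (card (F1 \<inter> B))"
        using finite_subset[OF \<open>B \<subseteq> V\<close> fin] a by simp
      ultimately show False using F1_max[OF f_comp[OF n(1)]] by simp
    qed
    define D where "D = \<Union>comp - B"
    \<comment> \<open>By \<open>dom\<close>, this is the union of the component.\<close>
    define W where "W = D \<union> (F1 \<inter> B)"
    have in_comp: "F \<in> comp" if "F \<in> \<G>" "x \<in> F" "x \<in> D" for F x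
    proof -
      obtain F' where F': "F' \<in> comp" "x \<in> F'" "x \<notin> B" using \<open>x \<in> D\<close> by (auto simp: D_def)
      then have "?R F' F" using comp_sub[of F'] that by auto
      then show ?thesis using F'(1) unfolding comp_def by (auto intro: rtranclp.rtrancl_into_rtrancl)
    qed
    have F_W: "F \<subseteq> W" if "F \<in> comp" for F
      using dom[OF that] that by (auto simp: W_def D_def)
    have "W \<subseteq> V"
      using comp_sub FV \<open>B \<subseteq> V\<close> by (auto simp: W_def D_def \<G>_def)
    moreover have "W \<noteq> V"
    proof
      assume "W = V"
      \<comment> \<open>\<open>F1\<close> is not inside \<open>B\<close>, so it would properly
        contain the maximal \<open>B\<close>.\<close>
      then have "B \<subseteq> F1" using \<open>B \<subseteq> V\<close> by (auto simp: W_def D_def)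
      then show False using comp_sub[OF F1] maxB[of F1] by auto
    qed
    ultimately have W: "W \<subset> V" by blast
    let ?T = "(\<lambda>F. F \<inter> W) ` \<G>"
    have "d \<in> W" using d F0_comp F0 by (auto simp: W_def D_def)
    have "\<exists>v\<in>W - B \<inter> W. nest_point ?T v"
    proof (rule less.hyps)
      show "card W < card V" using W fin by (rule psubset_card_mono[rotated])
      show "finite W" using W fin by (auto intro: finite_subset)
      show "totally_balanced ?T" using tb by (rule totally_balanced_trace) (auto simp: \<G>_def)
      show "B \<inter> W \<in> ?T" using B by blast
      show "B \<inter> W \<noteq> W" using \<open>d \<in> W\<close> d by blast
    qed auto
    then obtain v where v: "v \<in> W" "v \<notin> B" "nest_point ?T v" by blast
    have "nest_point \<F> v"
      unfolding nest_point_def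
    proof (intro ballI impI)
      fix F F' assume F: "F \<in> \<F>" "F' \<in> \<F>" "v \<in> F" "v \<in> F'"
      show "F \<subseteq> F' \<or> F' \<subseteq> F"
      proof (cases "F = V \<or> F' = V")
        case True then show ?thesis using F FV by auto
      next
        case False
        then have G: "F \<in> \<G>" "F' \<in> \<G>" using F by (auto simp: \<G>_def)
        have "v \<in> D" using v by (auto simp: W_def)
        then have "F \<inter> W = F" "F' \<inter> W = F'" using F_W in_comp G F by blast+
        then show ?thesis using v(3) G F unfolding nest_point_def by (metis image_eqI)
      qed
    qed
    then show ?thesis using v W by blast
  qed
  then show ?case using B by blast
qed

corollary nest_point_exists:
  assumes "finite V" "V \<noteq> {}" "\<F> \<subseteq> Pow V" "totally_balanced \<F>"
  shows "\<exists>v\<in>V. nest_point \<F> v"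
proof (cases "\<F> \<subseteq> {V}")
  case True
  then have "nest_point \<F> v" for v unfolding nest_point_def by blast
  then show ?thesis using assms(2) by blast
next
  case False
  then show ?thesis using nest_point_outside[OF assms(1,3,4)] by blast
qed

section \<open>Labelings from totally balanced families\<close>

text \<open>A vine is a clique whose edge labels form an MAT-labeling of the complete graph on it. The
  edge of largest label \<open>card B - 2\<close> is unique, and deleting either end leaves a vine.\<close>

inductive vine :: "('a \<Rightarrow> 'a \<Rightarrow> nat) \<Rightarrow> 'a set \<Rightarrow> bool" for L where
  vine_base: "finite B \<Longrightarrow> card B \<le> 1 \<Longrightarrow> vine L B"
| vine_step: "finite B \<Longrightarrow> a \<in> B \<Longrightarrow> b \<in> B \<Longrightarrow> a \<noteq> b \<Longrightarrow> card B = L a b + 2 \<Longrightarrow>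
     vine L (B - {a}) \<Longrightarrow> vine L (B - {b}) \<Longrightarrow> vine L B"

lemma vine_finite: "vine L B \<Longrightarrow> finite B"
  by (cases rule: vine.cases) auto

text \<open>Any edge other than the top one survives the deletion of a suitable end of the top edge,
  so the bound for the smaller vine applies.\<close>

lemma vine_label_bound:
  assumes "vine L B" "\<And>x y. L x y = L y x" "x \<in> B" "y \<in> B" "x \<noteq> y"
  shows "L x y + 2 \<le> card B"
  using assms
proof (induction rule: vine.induct)
  case (vine_base B)
  then have "card {x, y} \<le> card B" by (intro card_mono) auto
  then show ?case using vine_base by simp
next
  case (vine_step B a b)
  show ?case
  proof (cases "x \<noteq> a \<and> y \<noteq> a \<or> x \<noteq> b \<and> y \<noteq> b")
    case True
    then have "L x y + 2 \<le> card (B - {a}) \<or> L x y + 2 \<le> card (B - {b})"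
      using vine_step by auto
    then show ?thesis using vine_step.hyps(2,3) by (simp add: card_Diff_singleton)
  next
    case False
    then have "{x, y} = {a, b}" using vine_step.prems(4) vine_step.hyps(4) by auto
    then have "L x y = L a b" using vine_step.prems(1) by (auto simp: doubleton_eq_iff)
    then show ?thesis using vine_step by simp
  qed
qed

lemma vine_cong:
  assumes "vine L B" "\<And>x y. x \<in> B \<Longrightarrow> y \<in> B \<Longrightarrow> L x y = L' x y"
  shows "vine L' B"
  using assms
proof (induction rule: vine.induct)
  case (vine_base B) then show ?case by (simp add: vine.vine_base)
next
  case (vine_step B a b)
  then show ?case by (intro vine.vine_step[of B a b]) auto
qed

text \<open>The top edge of \<open>B\<close> has label \<open>card B - 2\<close>, which is too large
  for an edge inside the smaller vine \<open>A\<close>. So one of its ends lies outside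
  \<open>A\<close> and may be deleted.\<close>

lemma vine_remove_outside:
  assumes "vine L A" "vine L B" "A \<subset> B" "\<And>x y. L x y = L y x"
  obtains x where "x \<in> B" "x \<notin> A" "vine L (B - {x})"
  using assms(2)
proof (cases rule: vine.cases)
  case vine_base
  moreover have "B \<noteq> {}" using assms(3) by blast
  ultimately have "card B = 1" using card_gt_0_iff[of B] by linarith
  then obtain x where "B = {x}" by (rule card_1_singletonE)
  then show ?thesis using that[of x] assms(3) vine.vine_base[of "{}" L] by auto
next
  case (vine_step a b)
  have "\<not> (a \<in> A \<and> b \<in> A)"
    using vine_label_bound[OF assms(1,4), of a b] vine_step psubset_card_mono[OF vine_step(1) assms(3)] by auto
  then show ?thesis using that[of a] that[of b] vine_step by auto
qed

text \<open>The order is built from its end: the last vertex is chosen by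
  \<open>vine_remove_outside\<close> outside the largest proper member of the chain, so every proper
  member survives in the remaining vine.\<close>

lemma vine_chain_list:
  assumes "vine L C" "\<And>A. A \<in> \<C> \<Longrightarrow> vine L A \<and> A \<subseteq> C"
    "\<And>A A'. A \<in> \<C> \<Longrightarrow> A' \<in> \<C> \<Longrightarrow> A \<subseteq> A' \<or> A' \<subseteq> A" "\<And>x y. L x y = L y x"
  shows "\<exists>cs. distinct cs \<and> set cs = C \<and> (\<forall>j. vine L (set (take j cs))) \<and>
    (\<forall>A\<in>\<C>. A = set (take (card A) cs))"
  using assms(1-3)
proof (induction "card C" arbitrary: C \<C>)
  case 0
  then have "C = {}" using vine_finite[of L C] by auto
  then show ?case using 0 by (intro exI[of _ "[]"]) (auto intro: vine.vine_base)
next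
  case (Suc n)
  have finC: "finite C" using Suc.prems(1) by (rule vine_finite)
  have "finite \<C>" using Suc.prems(2) finC by (meson PowI finite_Pow_iff finite_subset subsetI)
  have "\<exists>A. vine L A \<and> A \<subset> C \<and> (\<forall>A'\<in>\<C> - {C}. A' \<subseteq> A)"
  proof (cases "\<C> - {C} = {}")
    case True
    then show ?thesis using Suc.hyps(2) by (intro exI[of _ "{}"]) (auto intro: vine.vine_base)
  next
    case False
    then obtain A where A: "A \<in> \<C> - {C}" "\<And>A'. A' \<in> \<C> - {C} \<Longrightarrow> A \<subseteq> A' \<Longrightarrow> A = A'"
      using finite_has_maximal[of "\<C> - {C}"] \<open>finite \<C>\<close> by (metis finite_Diff)
    have "A' \<subseteq> A" if "A' \<in> \<C> - {C}" for A'
      using A(2)[OF that] Suc.prems(3)[of A A'] A(1) that by auto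
    moreover have "vine L A" "A \<subset> C" using Suc.prems(2)[of A] A(1) by auto
    ultimately show ?thesis by blast
  qed
  then obtain A where A: "vine L A" "A \<subset> C" "\<And>A'. A' \<in> \<C> - {C} \<Longrightarrow> A' \<subseteq> A" by blast
  obtain x where x: "x \<in> C" "x \<notin> A" "vine L (C - {x})"
    using vine_remove_outside[OF A(1) Suc.prems(1) A(2) assms(4)] .
  have "n = card (C - {x})" using Suc.hyps(2) x by (simp add: card_Diff_singleton)
  then have "\<exists>cs. distinct cs \<and> set cs = C - {x} \<and> (\<forall>j. vine L (set (take j cs))) \<and>
      (\<forall>A\<in>\<C> - {C}. A = set (take (card A) cs))"
  proof (rule Suc.hyps(1))
    show "vine L (C - {x})" by (rule x(3))
    show "vine L A' \<and> A' \<subseteq> C - {x}" if "A' \<in> \<C> - {C}" for A'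
      using Suc.prems(2)[of A'] A(3)[OF that] x(2) that by blast
    show "A1 \<subseteq> A2 \<or> A2 \<subseteq> A1" if "A1 \<in> \<C> - {C}" "A2 \<in> \<C> - {C}" for A1 A2
      using Suc.prems(3)[of A1 A2] that by blast
  qed
  then obtain cs where "distinct cs \<and> set cs = C - {x} \<and> (\<forall>j. vine L (set (take j cs))) \<and>
      (\<forall>A\<in>\<C> - {C}. A = set (take (card A) cs))" ..
  then have cs: "distinct cs" "set cs = C - {x}" "\<And>j. vine L (set (take j cs))"
    and cs_take: "\<forall>A\<in>\<C> - {C}. A = set (take (card A) cs)" by simp_all
  have len: "length cs = n" using cs(1,2) \<open>n = card (C - {x})\<close> by (metis distinct_card)
  have setC: "set (cs @ [x]) = C" using cs(2) x by auto
  have "vine L (set (take j (cs @ [x])))" for j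
    using cs(3)[of j] setC Suc.prems(1) by (cases "j \<le> n") (auto simp: len)
  moreover have "B = set (take (card B) (cs @ [x]))" if "B \<in> \<C>" for B
  proof (cases "B = C")
    case True
    have "take (card C) (cs @ [x]) = cs @ [x]" using len Suc.hyps(2) by simp
    then show ?thesis using setC True by simp
  next
    case False
    then have B: "B = set (take (card B) cs)" using that by (intro cs_take[rule_format]) simp
    have "B \<subset> C" using Suc.prems(2)[OF that] False by auto
    then have "card B < card C" by (rule psubset_card_mono[OF finC])
    then have "card B \<le> n" using Suc.hyps(2) by linarith
    then have "take (card B) (cs @ [x]) = take (card B) cs" using len by simp
    then show ?thesis using B by simp
  qed
  moreover have "distinct (cs @ [x])" using cs(1,2) by auto
  ultimately show ?case using setC by (intro exI[of _ "cs @ [x]"] conjI ballI allI)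
qed

section \<open>Adding one vertex to a labeling\<close>

lemma rtranclp_map_steps:
  assumes "P\<^sup>*\<^sup>* a b" "\<And>a b. P a b \<Longrightarrow> f a = f b \<or> Q (f a) (f b)"
  shows "Q\<^sup>*\<^sup>* (f a) (f b)"
  using assms(1)
proof (induction rule: rtranclp_induct)
  case (step b c)
  then show ?case using assms(2)[of b c] by (metis rtranclp.rtrancl_into_rtrancl)
qed simp

text \<open>No label occurs twice at \<open>v\<close>. Walks of a fixed label \<open>k\<close> in
  the new graph can thus be projected to the old one by \<open>\<phi> k\<close>, which contracts
  \<open>v\<close> onto its only neighbour of label \<open>k\<close> if there is one; the old
  acyclicity and closure conditions then apply.\<close>

lemma mat_labeling_add_vertex:
  fixes E :: "'a::finite \<Rightarrow> 'a \<Rightarrow> bool"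
  assumes lab: "mat_labeling E L" and cs: "distinct cs" "v \<notin> set cs"
    and isolated: "\<And>x. \<not> E v x"
    and clique: "\<And>x y. x \<in> set cs \<Longrightarrow> y \<in> set cs \<Longrightarrow> x \<noteq> y \<Longrightarrow> E x y"
    and vine: "\<And>j. vine L (set (take j cs))"
    and idx: "\<And>j. j < length cs \<Longrightarrow> idx (cs ! j) = j"
  defines "E' \<equiv> \<lambda>a b. E a b \<or> a = v \<and> b \<in> set cs \<or> b = v \<and> a \<in> set cs"
    and "L' \<equiv> \<lambda>a b. if a = v then idx b else if b = v then idx a else L a b"
  shows "mat_labeling E' L'"
proof -
  interpret mat_labeling E L by (rule lab)
  have isolated': "\<not> E x v" for x using isolated E_commute by blast
  have idx_lt: "idx x < length cs" and idx_nth: "cs ! idx x = x" if "x \<in> set cs" for x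
    using that idx by (auto simp: in_set_conv_nth)
  have idx_inj: "x = y" if "x \<in> set cs" "y \<in> set cs" "idx x = idx y" for x y
    using idx_nth that by metis
  \<comment> \<open>The prefix ending with \<open>y\<close> is a vine on at most
    \<open>idx y + 1\<close> vertices, so \<open>vine_label_bound\<close> gives
    \<open>L x y + 2 \<le> idx y + 1\<close>.\<close>
  have L_lt: "L x y < idx y" if "x \<in> set cs" "y \<in> set cs" "idx x < idx y" for x y
  proof -
    let ?B = "set (take (Suc (idx y)) cs)"
    have "cs ! i \<in> ?B" if "i \<le> idx y" for i
      using nth_mem[of i "take (Suc (idx y)) cs"] idx_lt[OF \<open>y \<in> set cs\<close>] that by simp
    then have "cs ! idx x \<in> ?B" "cs ! idx y \<in> ?B" using that(3) by auto
    then have "x \<in> ?B" "y \<in> ?B" using idx_nth that by auto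
    then have "L x y + 2 \<le> card ?B"
      using vine_label_bound[OF vine L_commute] that by blast
    also have "\<dots> \<le> Suc (idx y)" using card_length[of "take (Suc (idx y)) cs"] by simp
    finally show ?thesis by simp
  qed
  have E'_iff: "E' a b \<longleftrightarrow> E a b" if "a \<noteq> v" "b \<noteq> v" for a b using that by (simp add: E'_def)
  have E'_v: "E' v b \<longleftrightarrow> b \<in> set cs" "E' b v \<longleftrightarrow> b \<in> set cs" for b
    using isolated isolated' cs by (auto simp: E'_def)
  have L'_eq: "L' a b = L a b" if "a \<noteq> v" "b \<noteq> v" for a b using that by (simp add: L'_def)
  have L'_v: "L' v b = idx b" "L' b v = idx b" for b by (auto simp: L'_def)
  have E'_comm: "E' a b \<longleftrightarrow> E' b a" for a b using E_commute by (auto simp: E'_def)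
  have L'_comm: "L' a b = L' b a" for a b using L_commute by (auto simp: L'_def)
  define \<phi> where "\<phi> k x = (if x = v \<and> k < length cs then cs ! k else x)" for k x
  have \<phi>_other: "\<phi> k x = x" if "x \<noteq> v" for k x using that by (simp add: \<phi>_def)
  have \<phi>_cs: "\<phi> k v = x" if "x \<in> set cs" "idx x = k" for k x
    using that idx_nth idx_lt by (auto simp: \<phi>_def)
  have step: "\<phi> k a = \<phi> k b \<or> a \<noteq> v \<and> b \<noteq> v" if "E' a b" "L' a b = k" for a b k
  proof (cases "a = v \<or> b = v")
    case True
    then show ?thesis
    proof
      assume "a = v"
      then have "b \<in> set cs" "idx b = k" using that E'_v L'_v by auto
      then show ?thesis using \<phi>_cs \<phi>_other[of b] cs(2) \<open>a = v\<close> by metis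
    next
      assume "b = v"
      then have "a \<in> set cs" "idx a = k" using that E'_v L'_v by auto
      then show ?thesis using \<phi>_cs \<phi>_other[of a] cs(2) \<open>b = v\<close> by metis
    qed
  qed simp
  show ?thesis
  proof
    show "symp E'" using E'_comm by (auto intro: sympI)
    show "irreflp E'" using cs(2) by (auto simp: E'_def intro!: irreflpI)
    show "L' a b = L' b a" for a b by (rule L'_comm)
  next
    fix u w assume uw: "E' u w"
    define P where "P = (\<lambda>a b. E' a b \<and> L' a b = L' u w \<and> {a, b} \<noteq> {u, w})"
    have P_sym: "symp P" using E'_comm L'_comm unfolding P_def by (intro sympI) (auto simp: insert_commute)
    \<comment> \<open>Leaving \<open>v\<close> would need a second edge at \<open>v\<close> of the
      same label.\<close>
    have no_v: "\<not> P\<^sup>*\<^sup>* v x" if "E' v x" "{v, x} = {u, w}" for x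
    proof
      assume "P\<^sup>*\<^sup>* v x"
      moreover have "x \<in> set cs" "x \<noteq> v" using that(1) E'_v cs(2) by auto
      ultimately obtain y where y: "P v y" by (metis converse_rtranclpE)
      have "L' u w = idx x" using that(2) L'_v by (auto simp: doubleton_eq_iff)
      then have "idx y = idx x" "y \<in> set cs" using y L'_v E'_v by (auto simp: P_def)
      then have "y = x" using idx_inj \<open>x \<in> set cs\<close> by blast
      then show False using y that(2) by (auto simp: P_def)
    qed
    have "\<not> P\<^sup>*\<^sup>* u w"
    proof (cases "u = v \<or> w = v")
      case True
      then show ?thesis
      proof
        assume "u = v" then show ?thesis using no_v[of w] uw by auto
      next
        assume "w = v"
        then show ?thesis
          using no_v[of u] uw E'_comm sympD[OF symp_rtranclp[OF P_sym], of u w] by (auto simp: insert_commute)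
      qed
    next
      case False
      let ?Q = "\<lambda>a b. E a b \<and> L a b = L u w \<and> {a, b} \<noteq> {u, w}"
      have uw_eq: "E u w" "L' u w = L u w" using False uw E'_iff L'_eq by auto
      have "\<phi> (L u w) a = \<phi> (L u w) b \<or> ?Q (\<phi> (L u w) a) (\<phi> (L u w) b)" if "P a b" for a b
        using step[of a b "L u w"] that uw_eq \<phi>_other E'_iff L'_eq by (auto simp: P_def)
      then have "?Q\<^sup>*\<^sup>* (\<phi> (L u w) u) (\<phi> (L u w) w)" if "P\<^sup>*\<^sup>* u w"
        using rtranclp_map_steps[of P u w "\<phi> (L u w)" ?Q] that by blast
      then show ?thesis using label_acyclic[OF uw_eq(1)] \<phi>_other False by auto
    qed
    then show "\<not> (\<lambda>a b. E' a b \<and> L' a b = L' u w \<and> {a, b} \<noteq> {u, w})\<^sup>*\<^sup>* u w"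
      by (simp add: P_def)
  next
    fix u w k assume uw: "E' u w" "L' u w < k"
    let ?P = "\<lambda>a b. E' a b \<and> L' a b = k" and ?Q = "\<lambda>a b. E a b \<and> L a b = k"
    have map: "?Q\<^sup>*\<^sup>* (\<phi> k a) (\<phi> k b)" if "?P\<^sup>*\<^sup>* a b" for a b
      using that
    proof (rule rtranclp_map_steps)
      fix a b assume "?P a b"
      then show "\<phi> k a = \<phi> k b \<or> ?Q (\<phi> k a) (\<phi> k b)"
        using step[of a b k] \<phi>_other E'_iff L'_eq by auto
    qed
    have no_v: "\<not> ?P\<^sup>*\<^sup>* v x" if "x \<in> set cs" "idx x < k" for x
    proof
      assume "?P\<^sup>*\<^sup>* v x"
      moreover have "x \<noteq> v" using cs(2) that by auto
      ultimately have Q: "?Q\<^sup>*\<^sup>* (\<phi> k v) x" using map[of v x] \<phi>_other[of x] by simp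
      show False
      proof (cases "k < length cs")
        \<comment> \<open>\<open>v\<close> is contracted onto \<open>cs ! k\<close>, which is joined
          to \<open>x\<close> by an old edge of label less than \<open>k\<close>; the old closure
          condition forbids a walk of label \<open>k\<close> between them.\<close>
        case True
        then have c: "cs ! k \<in> set cs" "idx (cs ! k) = k" using idx by auto
        then have "cs ! k \<noteq> x" using that by auto
        then have "E (cs ! k) x" "L (cs ! k) x < k"
          using c clique[of "cs ! k" x] L_lt[of x "cs ! k"] that L_commute[of x "cs ! k"] by auto
        moreover have "\<phi> k v = cs ! k" using True by (simp add: \<phi>_def)
        ultimately show False using label_closed[of "cs ! k" x k] Q by simp
      next
        case False
        then have "?Q\<^sup>*\<^sup>* v x" using Q by (simp add: \<phi>_def)
        moreover have "x \<noteq> v" using that cs by auto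
        ultimately show False by (cases rule: converse_rtranclpE) (use isolated in auto)
      qed
    qed
    have P_sym: "symp ?P" using E'_comm L'_comm by (intro sympI) auto
    show "\<not> ?P\<^sup>*\<^sup>* u w"
    proof (cases "u = v \<or> w = v")
      case True
      then show ?thesis
      proof
        assume "u = v" then show ?thesis using no_v[of w] uw E'_v L'_v by auto
      next
        assume "w = v"
        then have "\<not> ?P\<^sup>*\<^sup>* w u" using no_v[of u] uw E'_v L'_v by auto
        then show ?thesis using sympD[OF symp_rtranclp[OF P_sym], of u w] by blast
      qed
    next
      case False
      then have "E u w" "L u w < k" using uw E'_iff L'_eq by auto
      then have "\<not> ?Q\<^sup>*\<^sup>* u w" by (rule label_closed)
      moreover have "?Q\<^sup>*\<^sup>* u w" if "?P\<^sup>*\<^sup>* u w" using map[OF that] \<phi>_other False by simp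
      ultimately show ?thesis by blast
    qed
  next
    fix u w assume uw: "E' u w"
    let ?A = "\<lambda>u w. {x. E' u x \<and> E' w x \<and> L' u x < L' u w \<and> L' w x < L' u w}"
    have at_v: "card (?A v x) = idx x" if x: "x \<in> set cs" for x
    proof -
      \<comment> \<open>The apexes of the edge from \<open>v\<close> to \<open>x\<close> are exactly
        the \<open>idx x\<close> neighbours placed before \<open>x\<close>.\<close>
      have "?A v x = (!) cs ` {..<idx x}"
      proof (intro equalityI subsetI)
        fix y assume "y \<in> ?A v x"
        then have "y \<in> set cs" "idx y < idx x" using E'_v L'_v by auto
        then show "y \<in> (!) cs ` {..<idx x}" using idx_nth[of y] by (metis imageI lessThan_iff)
      next
        fix y assume "y \<in> (!) cs ` {..<idx x}"
        then obtain j where j: "y = cs ! j" "j < idx x" by auto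
        then have y: "y \<in> set cs" "idx y = j" using idx[of j] idx_lt[OF x] by auto
        then have "x \<noteq> y" "x \<noteq> v" "y \<noteq> v" using j cs x by auto
        then show "y \<in> ?A v x"
          using y x j(2) clique[of x y] L_lt[of y x] L_commute[of x y] E'_v L'_v E'_iff L'_eq by auto
      qed
      moreover have "inj_on ((!) cs) {..<idx x}"
        using cs(1) idx_lt[OF x] by (auto simp: inj_on_def nth_eq_iff_index_eq)
      ultimately show ?thesis by (simp add: card_image)
    qed
    show "card (?A u w) = L' u w"
    proof (cases "u = v \<or> w = v")
      case True
      then show ?thesis
      proof
        assume "u = v" then show ?thesis using at_v[of w] uw E'_v L'_v by simp
      next
        assume w: "w = v"
        have "?A u w = ?A w u" using L'_comm[of u w] by auto
        then show ?thesis using at_v[of u] w uw E'_v L'_v by simp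
      qed
    next
      case False
      \<comment> \<open>The old label of an edge inside \<open>cs\<close> is less than the larger
        index of its ends, so one of the two edges to \<open>v\<close> is not low enough and old
        triangle counts do not change.\<close>
      have "v \<notin> ?A u w"
      proof
        assume "v \<in> ?A u w"
        then have "u \<in> set cs" "w \<in> set cs" "idx u < L u w" "idx w < L u w"
          using E'_v L'_v L'_eq False by auto
        moreover have "u \<noteq> w" using uw False E'_iff by auto
        ultimately show False
          using L_lt[of u w] L_lt[of w u] L_commute[of u w] idx_inj[of u w]
          by (cases "idx u" "idx w" rule: linorder_cases) auto
      qed
      then have "?A u w = {x. E u x \<and> E w x \<and> L u x < L u w \<and> L w x < L u w}"
        using E'_iff L'_eq False isolated' by (auto simp: E'_def L'_def)
      then show ?thesis using card_triangles[of u w] uw False E'_iff L'_eq by auto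
    qed
  qed
qed

text \<open>The new top edge joins \<open>v\<close> to the last vertex of the prefix. Deleting
  \<open>v\<close> leaves an old prefix; deleting the other end leaves \<open>v\<close> with a
  shorter prefix.\<close>

lemma vine_add_vertex:
  assumes cs: "distinct cs" "v \<notin> set cs" and vine: "\<And>j. vine L (set (take j cs))"
    and idx: "\<And>j. j < length cs \<Longrightarrow> idx (cs ! j) = j"
  defines "L' \<equiv> \<lambda>a b. if a = v then idx b else if b = v then idx a else L a b"
  shows "vine L' (insert v (set (take j cs)))"
proof (induction j)
  case 0
  then show ?case by (auto intro: vine.vine_base)
next
  case (Suc j)
  show ?case
  proof (cases "j < length cs")
    case True
    let ?B = "insert v (set (take (Suc j) cs))"
    have v: "v \<notin> set (take i cs)" for i using cs(2) by (auto dest: in_set_takeD)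
    have nv: "cs ! j \<noteq> v" using cs(2) True by auto
    have take: "set (take (Suc j) cs) = insert (cs ! j) (set (take j cs))"
      using True by (simp add: take_Suc_conv_app_nth)
    have nj: "cs ! j \<notin> set (take j cs)"
      using True cs(1) by (auto simp: in_set_conv_nth nth_eq_iff_index_eq)
    have card: "card (set (take i cs)) = i" if "i \<le> length cs" for i
      using that cs(1) distinct_card[of "take i cs"] by simp
    show ?thesis
    proof (rule vine.vine_step[of _ v "cs ! j"])
      show "card ?B = L' v (cs ! j) + 2" using v card[of "Suc j"] True idx by (simp add: L'_def)
      have "vine L' (set (take (Suc j) cs))"
        using vine by (rule vine_cong) (use v in \<open>auto simp: L'_def\<close>)
      then show "vine L' (?B - {v})" using v by simp
      have "?B - {cs ! j} = insert v (set (take j cs))" using take nj nv by auto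
      then show "vine L' (?B - {cs ! j})" using Suc.IH by simp
    qed (use take nv in auto)
  next
    case False
    then show ?thesis using Suc.IH by simp
  qed
qed

definition comembers :: "'a set set \<Rightarrow> 'a \<Rightarrow> 'a \<Rightarrow> bool" where
  "comembers \<F> a b \<longleftrightarrow> a \<noteq> b \<and> (\<exists>F\<in>\<F>. a \<in> F \<and> b \<in> F)"

text \<open>The last clause says that the labels in use form an initial segment; it is carried along
  because the blocks of a partition are nonempty. It survives the step since the labels at
  \<open>v\<close> run through all positions of \<open>cs\<close>.\<close>

lemma totally_balanced_labeling:
  fixes \<F> :: "'a::finite set set"
  assumes "\<F> \<subseteq> Pow V" "totally_balanced \<F>"
  shows "\<exists>L. mat_labeling (comembers \<F>) L \<and> (\<forall>F\<in>\<F>. vine L F) \<and>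
    (\<forall>a b k. comembers \<F> a b \<longrightarrow> k \<le> L a b \<longrightarrow> (\<exists>c d. comembers \<F> c d \<and> L c d = k))"
  using assms
proof (induction "card V" arbitrary: V \<F>)
  case 0
  then have F: "F = {}" if "F \<in> \<F>" for F using that by auto
  then have no: "\<not> comembers \<F> a b" for a b by (auto simp: comembers_def)
  have "mat_labeling (comembers \<F>) (\<lambda>_ _. 0)"
    by standard (auto simp: no intro: sympI irreflpI)
  moreover have "vine (\<lambda>_ _. 0) F" if "F \<in> \<F>" for F using F[OF that] by (auto intro: vine.vine_base)
  ultimately show ?case using no by blast
next
  case (Suc n)
  have "V \<noteq> {}" using Suc.hyps(2) by auto
  then obtain v where v: "v \<in> V" "nest_point \<F> v"
    using nest_point_exists[OF finite _ Suc.prems] by blast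
  define \<G> where "\<G> = (\<lambda>F. F \<inter> (V - {v})) ` \<F>"
  have G_eq: "F \<inter> (V - {v}) = F - {v}" if "F \<in> \<F>" for F using that Suc.prems(1) by auto
  have "n = card (V - {v})" using Suc.hyps(2) v(1) by (simp add: card_Diff_singleton)
  moreover have "\<G> \<subseteq> Pow (V - {v})" by (auto simp: \<G>_def)
  moreover have "totally_balanced \<G>" unfolding \<G>_def by (rule totally_balanced_trace[OF Suc.prems(2)]) simp
  ultimately obtain L where L: "mat_labeling (comembers \<G>) L" and vine_G: "\<And>F. F \<in> \<G> \<Longrightarrow> vine L F"
    and range_L: "\<And>a b k. comembers \<G> a b \<Longrightarrow> k \<le> L a b \<Longrightarrow> \<exists>c d. comembers \<G> c d \<and> L c d = k"
    using Suc.hyps(1)[of "V - {v}" \<G>] by blast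
  interpret mat_labeling "comembers \<G>" L by (rule L)
  define \<C> where "\<C> = {F - {v} | F. F \<in> \<F> \<and> v \<in> F}"
  have C_G: "A \<in> \<G>" if "A \<in> \<C>" for A using that G_eq by (force simp: \<C>_def \<G>_def)
  have C_chain: "A \<subseteq> A' \<or> A' \<subseteq> A" if "A \<in> \<C>" "A' \<in> \<C>" for A A'
    using that v(2) by (auto simp: \<C>_def nest_point_def)
  \<comment> \<open>The union of a finite nonempty chain is one of its members, so the whole
    neighbourhood of \<open>v\<close> is a vine.\<close>
  have top: "\<Union>\<C> \<in> \<C>" if "\<C> \<noteq> {}"
    using that C_chain by (intro Union_in_chain) (auto simp: subset.chain_def)
  have "vine L (\<Union>\<C>)"
  proof (cases "\<C> = {}")
    case True then show ?thesis by (auto intro: vine.vine_base)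
  next
    case False then show ?thesis using top vine_G C_G by blast
  qed
  then have "\<exists>cs. distinct cs \<and> set cs = \<Union>\<C> \<and> (\<forall>j. vine L (set (take j cs))) \<and>
    (\<forall>A\<in>\<C>. A = set (take (card A) cs))"
    by (rule vine_chain_list) (use vine_G C_G C_chain L_commute in auto)
  then obtain cs where "distinct cs \<and> set cs = \<Union>\<C> \<and> (\<forall>j. vine L (set (take j cs))) \<and>
    (\<forall>A\<in>\<C>. A = set (take (card A) cs))" ..
  then have cs: "distinct cs" "set cs = \<Union>\<C>" "\<And>j. vine L (set (take j cs))"
    and cs_take: "\<forall>A\<in>\<C>. A = set (take (card A) cs)" by simp_all
  have v_cs: "v \<notin> set cs" using cs(2) by (auto simp: \<C>_def)
  obtain idx where idx: "\<And>j. j < length cs \<Longrightarrow> idx (cs ! j) = j"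
    using the_inv_into_f_f[OF inj_on_nth[OF cs(1), of "{..<length cs}"]] by (metis lessThan_iff)
  define L' where "L' = (\<lambda>a b. if a = v then idx b else if b = v then idx a else L a b)"
  have G_v: "\<not> comembers \<G> v x" for x by (auto simp: comembers_def \<G>_def)
  have comembers_eq: "comembers \<F> = (\<lambda>a b. comembers \<G> a b \<or> a = v \<and> b \<in> set cs \<or> b = v \<and> a \<in> set cs)"
  proof (intro ext)
    fix a b
    have at_v: "comembers \<F> v x \<longleftrightarrow> x \<in> set cs" for x
      unfolding cs(2) by (auto simp: comembers_def \<C>_def)
    have commute: "comembers \<H> x y \<longleftrightarrow> comembers \<H> y x" for \<H> :: "'a set set" and x y
      by (auto simp: comembers_def)
    have other: "comembers \<F> a b \<longleftrightarrow> comembers \<G> a b" if "a \<noteq> v" "b \<noteq> v"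
      using that Suc.prems(1) by (auto simp: comembers_def \<G>_def)
    show "comembers \<F> a b \<longleftrightarrow> comembers \<G> a b \<or> a = v \<and> b \<in> set cs \<or> b = v \<and> a \<in> set cs"
    proof (cases "a = v \<or> b = v")
      case True
      then show ?thesis
      proof
        assume "a = v" then show ?thesis using at_v[of b] G_v v_cs by blast
      next
        assume "b = v"
        then show ?thesis using at_v[of a] commute[of \<F> a v] commute[of \<G> a v] G_v v_cs by blast
      qed
    next
      case False then show ?thesis using other by blast
    qed
  qed
  have cs_clique: "comembers \<G> x y" if "x \<in> set cs" "y \<in> set cs" "x \<noteq> y" for x y
    using that top C_G unfolding cs(2) comembers_def by blast
  have "mat_labeling (comembers \<F>) L'"
    unfolding comembers_eq L'_def
    by (rule mat_labeling_add_vertex[OF L cs(1) v_cs G_v cs_clique cs(3) idx])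
  moreover have "vine L' F" if F: "F \<in> \<F>" for F
  proof (cases "v \<in> F")
    case True
    then have "F - {v} \<in> \<C>" using F by (auto simp: \<C>_def)
    then obtain j where "F - {v} = set (take j cs)" using cs_take[rule_format] by metis
    then have "F = insert v (set (take j cs))" using True by auto
    then show ?thesis
      using vine_add_vertex[OF cs(1) v_cs cs(3) idx, of j] unfolding L'_def by simp
  next
    case False
    then have "F \<inter> (V - {v}) = F" using G_eq[OF F] by blast
    then have "F \<in> \<G>" unfolding \<G>_def using F by (metis imageI)
    then have "vine L F" by (rule vine_G)
    then show ?thesis by (rule vine_cong) (use False in \<open>auto simp: L'_def\<close>)
  qed
  moreover have "\<exists>c d. comembers \<F> c d \<and> L' c d = k" if ab: "comembers \<F> a b" "k \<le> L' a b" for a b k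
  proof -
    have at_v: "\<exists>c d. comembers \<F> c d \<and> L' c d = k" if "x \<in> set cs" "k \<le> idx x" for x
    proof -
      obtain j where "j < length cs" "x = cs ! j" using \<open>x \<in> set cs\<close> by (auto simp: in_set_conv_nth)
      then have "k < length cs" using idx that by auto
      then have "comembers \<F> v (cs ! k)" "L' v (cs ! k) = k" using idx by (auto simp: comembers_eq L'_def)
      then show ?thesis by blast
    qed
    consider "a = v" | "b = v" | "a \<noteq> v" "b \<noteq> v" by blast
    then show ?thesis
    proof cases
      case 1
      then have "b \<in> set cs" using ab(1) G_v v_cs by (auto simp: comembers_eq)
      then show ?thesis using at_v[of b] ab(2) 1 by (simp add: L'_def)
    next
      case 2
      then have "a \<in> set cs" using ab(1) G_v v_cs E_commute[of a v] by (auto simp: comembers_eq)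
      moreover from this have "L' a b = idx a" using 2 v_cs by (auto simp: L'_def)
      ultimately show ?thesis using at_v[of a] ab(2) by simp
    next
      case 3
      then have "comembers \<G> a b" "k \<le> L a b" using ab by (auto simp: comembers_eq L'_def)
      then obtain c d where cd: "comembers \<G> c d" "L c d = k" using range_L by blast
      then have "c \<noteq> v" "d \<noteq> v" using G_v E_commute by blast+
      then show ?thesis using cd by (intro exI[of _ c] exI[of _ d]) (auto simp: comembers_eq L'_def)
    qed
  qed
  ultimately show ?case by blast
qed

section \<open>Cliques of strongly chordal graphs\<close>

text \<open>Among the members of the cycle, \<open>x i\<close> lies only in \<open>F i\<close> and
  its cyclic predecessor. Forbidding this for all \<open>n \<ge> 3\<close> is the usual definition
  of a totally balanced family.\<close>

definition special_cycle :: "'a set set \<Rightarrow> nat \<Rightarrow> (nat \<Rightarrow> 'a) \<Rightarrow> (nat \<Rightarrow> 'a set) \<Rightarrow> bool" where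
  "special_cycle \<F> n x F \<longleftrightarrow>
     (\<forall>i<n. F i \<in> \<F> \<and> (\<forall>j<n. x j \<in> F i \<longleftrightarrow> j = i \<or> j = (i + 1) mod n))"

text \<open>A shortest walk from the members containing \<open>a\<close> to those containing
  \<open>b\<close> closes up through \<open>A\<close>. The points are \<open>a\<close>, one point
  outside \<open>A\<close> from each step, and \<open>b\<close>; shortness removes all further
  incidences. The length \<open>k + 2\<close> is at least 3 because no member of the walk contains
  both \<open>a\<close> and \<open>b\<close>.\<close>

lemma special_cycle_if_not_totally_balanced:
  assumes "\<not> totally_balanced \<F>"
  shows "\<exists>n\<ge>3. \<exists>x F. special_cycle \<F> n x F"
proof -
  obtain A a b and f :: "nat \<Rightarrow> 'a set" and m where A: "A \<in> \<F>" "a \<in> A" "b \<in> A"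
    and f: "\<And>i. i \<le> m \<Longrightarrow> f i \<in> \<F>" "\<And>i. i < m \<Longrightarrow> \<not> f i \<inter> f (Suc i) \<subseteq> A" "a \<in> f 0" "b \<in> f m"
    and no: "\<And>i. i \<le> m \<Longrightarrow> \<not> (a \<in> f i \<and> b \<in> f i)"
    using assms unfolding totally_balanced_def by blast
  let ?R = "\<lambda>F F'. \<not> F \<inter> F' \<subseteq> A"
  have "f 0 \<in> {F. a \<in> F}" "f m \<in> {F. b \<in> F}" using f by auto
  then show ?thesis
  proof (rule shortest_walk[of f "{F. a \<in> F}" m "{F. b \<in> F}" ?R, OF _ _ f(2)])
    fix g k
    assume g: "g ` {..k} \<subseteq> f ` {..m}" "g 0 \<in> {F. a \<in> F}" "g k \<in> {F. b \<in> F}"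
      and g_step: "\<And>i. i < k \<Longrightarrow> ?R (g i) (g (Suc i))"
      and g_a: "\<And>i. i \<le> k \<Longrightarrow> g i \<in> {F. a \<in> F} \<Longrightarrow> i = 0"
      and g_b: "\<And>i. i \<le> k \<Longrightarrow> g i \<in> {F. b \<in> F} \<Longrightarrow> i = k"
      and g_short: "\<And>i j. i < j \<Longrightarrow> j \<le> k \<Longrightarrow> ?R (g i) (g j) \<Longrightarrow> j = Suc i"
    have g_f: "\<exists>t\<le>m. g i = f t" if "i \<le> k" for i using g(1) that by blast
    have g_F: "g i \<in> \<F>" if "i \<le> k" for i using g_f[OF that] f(1) by auto
    have "k \<noteq> 0"
    proof
      assume "k = 0"
      then have "a \<in> g 0" "b \<in> g 0" using g by auto
      then show False using g_f[of 0] no by auto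
    qed
    have "\<forall>i. \<exists>y. i < k \<longrightarrow> y \<in> g i \<and> y \<in> g (Suc i) \<and> y \<notin> A" using g_step by blast
    then obtain d where d: "\<And>i. i < k \<Longrightarrow> d i \<in> g i \<and> d i \<in> g (Suc i) \<and> d i \<notin> A" by metis
    have d_iff: "d j \<in> g i \<longleftrightarrow> i = j \<or> i = Suc j" if "j < k" "i \<le> k" for i j
    proof
      assume "d j \<in> g i"
      then have "i < Suc j \<Longrightarrow> Suc j = Suc i" "j < i \<Longrightarrow> i = Suc j"
        using g_short[of i "Suc j"] g_short[of j i] d[of j] that by auto
      then show "i = j \<or> i = Suc j" by linarith
    next
      assume "i = j \<or> i = Suc j"
      then show "d j \<in> g i" using d[of j] that by auto
    qed
    define x where "x j = (if j = 0 then a else if j \<le> k then d (j - 1) else b)" for j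
    define F where "F i = (if i \<le> k then g i else A)" for i
    have "special_cycle \<F> (k + 2) x F"
      unfolding special_cycle_def
    proof (intro allI impI conjI)
      fix i assume i: "i < k + 2"
      show "F i \<in> \<F>" using g_F A by (simp add: F_def)
      fix j assume j: "j < k + 2"
      consider "j = 0" | t where "j = Suc t" "t < k" | "j = Suc k" using j by (cases j) (auto simp: less_Suc_eq)
      then show "x j \<in> F i \<longleftrightarrow> j = i \<or> j = (i + 1) mod (k + 2)"
      proof cases
        case 1
        have "a \<in> g i \<longleftrightarrow> i = 0" if "i \<le> k" using g_a[OF that] g(2) by auto
        then show ?thesis using 1 i A by (auto simp: x_def F_def mod_Suc)
      next
        case 2
        have "d t \<in> F i \<longleftrightarrow> i = t \<or> i = Suc t"
          using d_iff[OF 2(2), of i] d[OF 2(2)] 2 i by (auto simp: F_def)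
        then show ?thesis using 2 i by (auto simp: x_def mod_Suc)
      next
        case 3
        have "b \<in> g i \<longleftrightarrow> i = k" if "i \<le> k" using g_b[OF that] g(3) by auto
        then show ?thesis using 3 i A by (auto simp: x_def F_def mod_Suc)
      qed
    qed
    then show ?thesis using \<open>k \<noteq> 0\<close> by (intro exI[of _ "k + 2"]) auto
  qed
qed

section \<open>Maximal cliques and induced suns\<close>

definition maximal_cliques :: "('a \<Rightarrow> 'a \<Rightarrow> bool) \<Rightarrow> 'a set set" where
  "maximal_cliques R = {K. clique_in R K \<and> (\<forall>K'. clique_in R K' \<longrightarrow> K \<subseteq> K' \<longrightarrow> K' = K)}"

lemma maximal_clique_exists:
  fixes R :: "'a::finite \<Rightarrow> 'a \<Rightarrow> bool"
  assumes "clique_in R K"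
  obtains M where "M \<in> maximal_cliques R" "K \<subseteq> M"
proof -
  obtain M where "M \<in> Collect (clique_in R)" "K \<subseteq> M"
    "\<And>K'. K' \<in> Collect (clique_in R) \<Longrightarrow> M \<subseteq> K' \<Longrightarrow> M = K'"
    using finite_has_maximal2[of "Collect (clique_in R)" K] assms by auto
  then show ?thesis using that[of M] by (auto simp: maximal_cliques_def)
qed

lemma comembers_maximal_cliques:
  fixes R :: "'a::finite \<Rightarrow> 'a \<Rightarrow> bool"
  assumes "symp R" "irreflp R"
  shows "comembers (maximal_cliques R) = R"
proof (intro ext iffI)
  fix a b assume "comembers (maximal_cliques R) a b"
  then show "R a b" by (auto simp: comembers_def maximal_cliques_def clique_in_def)
next
  fix a b assume "R a b"
  then have "clique_in R {a, b}" "a \<noteq> b"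
    using assms by (auto simp: clique_in_def dest: sympD irreflpD)
  then show "comembers (maximal_cliques R) a b"
    by (metis comembers_def insert_subset maximal_clique_exists)
qed

definition induced_sun :: "('a \<Rightarrow> 'a \<Rightarrow> bool) \<Rightarrow> nat \<Rightarrow> (nat \<Rightarrow> 'a) \<Rightarrow> (nat \<Rightarrow> 'a) \<Rightarrow> bool" where
  "induced_sun R n u w \<longleftrightarrow> inj_on u {..<n} \<and> inj_on w {..<n} \<and>
     (\<forall>i<n. \<forall>j<n. w i \<noteq> u j \<and> \<not> R (w i) (w j) \<and> (R (u i) (u j) \<longleftrightarrow> i \<noteq> j) \<and>
        (R (w i) (u j) \<longleftrightarrow> j = i \<or> j = (i + 1) mod n))"

lemma special_cycle_rotate:
  assumes "special_cycle \<F> n x F"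
  shows "special_cycle \<F> n (\<lambda>i. x ((i + r) mod n)) (\<lambda>i. F ((i + r) mod n))"
  unfolding special_cycle_def
proof (intro allI impI conjI)
  let ?s = "\<lambda>i. (i + r) mod n"
  fix i assume i: "i < n"
  then have lt: "?s j < n" for j by simp
  show "F (?s i) \<in> \<F>" using assms lt by (auto simp: special_cycle_def)
  fix j assume j: "j < n"
  have "x (?s j) \<in> F (?s i) \<longleftrightarrow> ?s j = ?s i \<or> ?s j = (?s i + 1) mod n"
    using assms lt by (auto simp: special_cycle_def)
  also have "\<dots> \<longleftrightarrow> j = i \<or> j = (i + 1) mod n"
    unfolding shift_mod_Suc using shift_mod_eq_iff[of j n i r] shift_mod_eq_iff[of j n "(i + 1) mod n" r] i j by auto
  finally show "x (?s j) \<in> F (?s i) \<longleftrightarrow> j = i \<or> j = (i + 1) mod n" .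
qed

text \<open>If \<open>K\<close> misses a point, it contains some \<open>x r\<close> but not the next
  point. The arc from \<open>x r\<close> to the next point in \<open>K\<close> is closed by
  \<open>K\<close> to a special cycle, which is shorter unless that point immediately precedes
  \<open>x r\<close>. So the points in \<open>K\<close> would be at most two neighbours on the
  cycle.\<close>

lemma minimal_special_cycle_trace:
  assumes sc: "special_cycle \<F> n x F" and n: "n \<ge> 3"
    and minimal: "\<And>k y H. 3 \<le> k \<Longrightarrow> k < n \<Longrightarrow> \<not> special_cycle \<F> k y H"
    and K: "K \<in> \<F>" and pq: "p < n" "q < n" "x p \<in> K" "x q \<in> K" "p \<noteq> q"
      "q \<noteq> (p + 1) mod n" "p \<noteq> (q + 1) mod n"
    and i: "i < n"
  shows "x i \<in> K"
proof (rule ccontr)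
  assume "x i \<notin> K"
  have "\<exists>r<n. x r \<in> K \<and> x ((r + 1) mod n) \<notin> K"
  proof (rule ccontr)
    assume "\<not> ?thesis"
    then have step: "x ((r + 1) mod n) \<in> K" if "r < n" "x r \<in> K" for r using that by blast
    have "x ((t + p) mod n) \<in> K" for t
    proof (induction t)
      case 0 then show ?case using pq by simp
    next
      case (Suc t)
      then show ?case using step[of "(t + p) mod n"] n by (simp add: mod_simps)
    qed
    from this[of "i + n - p"] show False using \<open>x i \<notin> K\<close> pq i by simp
  qed
  then obtain r where r: "r < n" "x r \<in> K" "x ((r + 1) mod n) \<notin> K" by blast
  define y where "y t = x ((t + r) mod n)" for t
  define G where "G t = F ((t + r) mod n)" for t
  have sc': "special_cycle \<F> n y G" using special_cycle_rotate[OF sc] unfolding y_def G_def .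
  have y0: "y 0 \<in> K" and y1: "y 1 \<notin> K" using r by (auto simp: y_def)
  define unshift where "unshift t = (t + n - r) mod n" for t
  have unshift: "(unshift t + r) mod n = t" "unshift t < n" if "t < n" for t
    using that r(1) n by (auto simp: unshift_def mod_simps)
  have last_only: "t = 0 \<or> t = n - 1" if t: "t < n" "y t \<in> K" for t
  proof (rule ccontr)
    assume "\<not> ?thesis"
    then have t0: "t \<noteq> 0" "t < n - 1" using t by auto
    have "\<exists>t. t \<noteq> 0 \<and> y t \<in> K" using t0 t by blast
    then obtain s where s: "s \<noteq> 0" "y s \<in> K" and s_least: "\<And>t. t < s \<Longrightarrow> \<not> (t \<noteq> 0 \<and> y t \<in> K)"
      using exists_least_iff[of "\<lambda>t. t \<noteq> 0 \<and> y t \<in> K"] by blast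
    have "s \<le> t" using s_least[of t] t0 t by (meson not_less)
    then have s2: "2 \<le> s" "s < n - 1" using s y1 t0 by (cases "s = 1"; auto)+
    \<comment> \<open>The length \<open>s + 1\<close> is at least 3 because \<open>y 1\<close> is
      outside \<open>K\<close>; the member \<open>K\<close> replaces the arc after
      \<open>y s\<close>.\<close>
    have "special_cycle \<F> (s + 1) y (\<lambda>i. if i < s then G i else K)"
      unfolding special_cycle_def
    proof (intro allI impI conjI)
      fix i assume i: "i < s + 1"
      show "(if i < s then G i else K) \<in> \<F>" using sc' K s2 by (auto simp: special_cycle_def)
      fix j assume j: "j < s + 1"
      show "y j \<in> (if i < s then G i else K) \<longleftrightarrow> j = i \<or> j = (i + 1) mod (s + 1)"
      proof (cases "i < s")
        case True
        then have "y j \<in> G i \<longleftrightarrow> j = i \<or> j = (i + 1) mod n"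
          using sc' j s2 by (auto simp: special_cycle_def)
        then show ?thesis using True s2 by simp
      next
        case False
        then have "i = s" using i by simp
        moreover have "y j \<in> K \<longleftrightarrow> j = 0 \<or> j = s"
          using s_least[of j] y0 s j by (cases "j = s") auto
        ultimately show ?thesis by auto
      qed
    qed
    then show False using minimal[of "s + 1"] s2 by auto
  qed
  have *: "t = r \<or> r = (t + 1) mod n" if t: "t < n" "x t \<in> K" for t
  proof -
    have "unshift t = 0 \<or> unshift t = n - 1" using last_only[of "unshift t"] unshift[OF t(1)] t by (simp add: y_def)
    then show ?thesis
    proof
      assume "unshift t = 0" then show ?thesis using unshift[OF t(1)] r by simp
    next
      assume "unshift t = n - 1"
      then have "t = (n - 1 + r) mod n" using unshift[OF t(1)] by simp
      then have "(t + 1) mod n = (n - 1 + r + 1) mod n" by (simp add: mod_simps)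
      also have "n - 1 + r + 1 = r + n" using n by simp
      finally show ?thesis using r by simp
    qed
  qed
  have "p = r \<or> r = (p + 1) mod n" "q = r \<or> r = (q + 1) mod n" using * pq by auto
  then show False using pq shift_mod_eq_iff[of p n q 1] by auto
qed

text \<open>Choose \<open>w\<close> with the fewest neighbours in \<open>S\<close>. Neighbourhoods
  in \<open>S\<close> of vertices of \<open>K\<close> are nested, as otherwise there is a chordless
  4-cycle; so a neighbour of \<open>w\<close> in \<open>S\<close> would be adjacent to all of
  \<open>K\<close>, against maximality.\<close>

lemma private_clique_vertex:
  fixes R :: "'a::finite \<Rightarrow> 'a \<Rightarrow> bool"
  assumes hf: "hole_free R" "symp R" "irreflp R" and K: "K \<in> maximal_cliques R" "K \<noteq> {}"
    and S: "clique_in R S" "S \<inter> K = {}"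
  shows "\<exists>w\<in>K. \<forall>s\<in>S. \<not> R w s"
proof (rule ccontr)
  assume no: "\<not> ?thesis"
  let ?N = "\<lambda>w. {s \<in> S. R w s}"
  have sym: "R a b \<longleftrightarrow> R b a" for a b using hf(2) by (auto dest: sympD)
  have cK: "clique_in R K" using K by (simp add: maximal_cliques_def)
  obtain w where w: "w \<in> K" "\<And>w'. w' \<in> K \<Longrightarrow> card (?N w) \<le> card (?N w')"
    using ex_has_least_nat[of "\<lambda>w. w \<in> K" _ "\<lambda>w. card (?N w)"] K(2) by blast
  obtain s where s: "s \<in> S" "R w s" using no w(1) by blast
  have "R w' s" if w': "w' \<in> K" for w'
  proof (rule ccontr)
    assume ns: "\<not> R w' s"
    have "\<not> ?N w' \<subseteq> ?N w - {s}"
    proof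
      assume "?N w' \<subseteq> ?N w - {s}"
      then have "card (?N w') \<le> card (?N w - {s})" by (intro card_mono) auto
      also have "\<dots> < card (?N w)" using s by (intro card_Diff1_less) auto
      finally show False using w(2)[OF w'] by simp
    qed
    then obtain s' where s': "s' \<in> S" "R w' s'" "\<not> R w s'" using ns by blast
    have ne: "w \<noteq> w'" "s \<noteq> s'" "w \<noteq> s'" "s \<noteq> w'" using s s' ns S(2) w(1) w' by auto
    have "R s s'" "R w' w" using ne S(1) cK s s' w(1) w' by (auto simp: clique_in_def)
    then have "R w s' \<or> R s w'"
      using hole_free_four_cycle[OF hf, of w s s' w'] s s' ne sym by blast
    then show False using s' ns sym by blast
  qed
  then have "clique_in R (insert s K)" using cK sym by (auto simp: clique_in_insert)
  then have "s \<in> K" using K(1) by (auto simp: maximal_cliques_def)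
  then show False using s(1) S(2) by blast
qed

text \<open>The points of a shortest special cycle of maximal cliques form the central clique, and a
  vertex of \<open>F i\<close> with no neighbour among the points outside \<open>F i\<close> serves
  as an outer vertex.\<close>

lemma induced_sun_if_special_cycle:
  fixes R :: "'a::finite \<Rightarrow> 'a \<Rightarrow> bool"
  assumes hf: "hole_free R" "symp R" "irreflp R"
    and ex: "\<exists>n\<ge>3. \<exists>x F. special_cycle (maximal_cliques R) n x F"
  shows "\<exists>n\<ge>3. \<exists>u w. induced_sun R n u w"
proof -
  let ?M = "maximal_cliques R"
  have sym: "R a b \<longleftrightarrow> R b a" for a b using hf(2) by (auto dest: sympD)
  have irr: "\<not> R a a" for a using hf(3) by (auto dest: irreflpD)
  obtain n where "3 \<le> n \<and> (\<exists>x F. special_cycle ?M n x F)"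
    and least: "\<And>k. k < n \<Longrightarrow> \<not> (3 \<le> k \<and> (\<exists>x F. special_cycle ?M k x F))"
    using ex exists_least_iff[of "\<lambda>n. 3 \<le> n \<and> (\<exists>x F. special_cycle ?M n x F)"] by blast
  then obtain x F where n: "n \<ge> 3" and sc: "special_cycle ?M n x F" by blast
  have F: "F i \<in> ?M" and xF: "x j \<in> F i \<longleftrightarrow> j = i \<or> j = (i + 1) mod n" if "i < n" "j < n" for i j
    using sc that by (auto simp: special_cycle_def)
  have F_clique: "R a b" if "i < n" "a \<in> F i" "b \<in> F i" "a \<noteq> b" for i a b
    using F[of i i] that by (auto simp: maximal_cliques_def clique_in_def)
  have Suc_mod: "Suc i mod n = (if Suc i = n then 0 else Suc i)" if "i < n" for i using that by auto
  have x_ne: "x i \<noteq> x j" if "i < n" "j < n" "i \<noteq> j" for i j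
  proof
    assume eq: "x i = x j"
    have "x j \<in> F i" "x i \<in> F j" using xF[of i i] xF[of j j] that eq by auto
    then have "j = Suc i mod n" "i = Suc j mod n" using xF[of i j] xF[of j i] that by auto
    then show False using that n by (auto simp: Suc_mod split: if_splits)
  qed
  have x_next: "R (x i) (x ((i + 1) mod n))" if "i < n" for i
  proof (rule F_clique[OF that])
    show "x i \<in> F i" "x ((i + 1) mod n) \<in> F i" using xF[of i i] xF[of i "(i + 1) mod n"] that n by auto
    show "x i \<noteq> x ((i + 1) mod n)" using x_ne[of i "(i + 1) mod n"] that n by (auto simp: Suc_mod split: if_splits)
  qed
  \<comment> \<open>An adjacent nonconsecutive pair lies in a maximal clique, which by minimality
    contains all points. Without such a pair the points form an induced cycle, and hole-freeness
    leaves only a triangle.\<close>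
  have x_clique: "R (x i) (x j)" if ij: "i < n" "j < n" "i \<noteq> j" for i j
  proof (cases "\<exists>p<n. \<exists>q<n. p \<noteq> q \<and> q \<noteq> (p + 1) mod n \<and> p \<noteq> (q + 1) mod n \<and> R (x p) (x q)")
    case True
    then obtain p q where pq: "p < n" "q < n" "p \<noteq> q" "q \<noteq> (p + 1) mod n" "p \<noteq> (q + 1) mod n"
      "R (x p) (x q)" by blast
    then have "comembers ?M (x p) (x q)" by (simp add: comembers_maximal_cliques[OF hf(2,3)])
    then obtain K where K: "K \<in> ?M" "x p \<in> K" "x q \<in> K" unfolding comembers_def by blast
    have "x t \<in> K" if "t < n" for t
      by (rule minimal_special_cycle_trace[OF sc n _ K(1) pq(1,2) K(2,3) pq(3-5) that]) (use least in blast)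
    then show ?thesis
      using K(1) ij x_ne[OF ij] by (auto simp: maximal_cliques_def clique_in_def)
  next
    case False
    have cyc: "R (x p) (x q) \<longleftrightarrow> q = (p + 1) mod n \<or> p = (q + 1) mod n" if "p < n" "q < n" for p q
    proof
      assume "R (x p) (x q)"
      moreover from this have "p \<noteq> q" using irr by auto
      ultimately show "q = (p + 1) mod n \<or> p = (q + 1) mod n" using False that by blast
    next
      assume "q = (p + 1) mod n \<or> p = (q + 1) mod n"
      then show "R (x p) (x q)" using x_next[of p] x_next[of q] that sym by auto
    qed
    have "inj_on x {..<n}" using x_ne by (auto simp: inj_on_def)
    then have "induced_cycle R n x" using cyc by (auto simp: induced_cycle_def)
    then have n3: "n = 3" using hf(1) n unfolding hole_free_def by (metis le_eq_less_or_eq)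
    have "i \<in> {0, 1, 2}" "j \<in> {0, 1, 2}" using ij n3 by auto
    then have "j = (i + 1) mod n \<or> i = (j + 1) mod n" using ij(3) n3 by auto
    then show ?thesis using cyc ij by blast
  qed
  define S where "S i = x ` {j. j < n \<and> j \<noteq> i \<and> j \<noteq> (i + 1) mod n}" for i
  have "\<exists>w\<in>F i. \<forall>s\<in>S i. \<not> R w s" if i: "i < n" for i
  proof (rule private_clique_vertex[OF hf F[OF i i]])
    show "F i \<noteq> {}" using xF[OF i i] by auto
    show "clique_in R (S i)" using x_clique by (auto simp: clique_in_def S_def)
    show "S i \<inter> F i = {}" using xF i by (auto simp: S_def)
  qed
  then obtain w where w: "\<And>i. i < n \<Longrightarrow> w i \<in> F i" "\<And>i s. i < n \<Longrightarrow> s \<in> S i \<Longrightarrow> \<not> R (w i) s"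
    by metis
  have third: "\<exists>t<n. t \<noteq> i \<and> t \<noteq> j" for i j
  proof -
    have "\<not> {0, 1, 2} \<subseteq> {i, j}" by auto
    then have "\<exists>t\<in>{0, 1, 2}. t \<noteq> i \<and> t \<noteq> j" by blast
    moreover have "t < n" if "t \<in> {0, 1, 2}" for t using n that by auto
    ultimately show ?thesis by blast
  qed
  have w_x: "w i \<noteq> x j" if i: "i < n" and j: "j < n" for i j
  proof
    assume eq: "w i = x j"
    then have j': "j = i \<or> j = (i + 1) mod n" using w(1)[OF i] xF[OF i j] by simp
    obtain t where t: "t < n" "t \<noteq> i" "t \<noteq> (i + 1) mod n" using third by blast
    then have "R (x j) (x t)" using x_clique j j' by auto
    moreover have "x t \<in> S i" using t by (auto simp: S_def)
    ultimately show False using w(2)[OF i] eq by auto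
  qed
  have w_adj: "R (w i) (x j) \<longleftrightarrow> j = i \<or> j = (i + 1) mod n" if i: "i < n" and j: "j < n" for i j
  proof
    assume "R (w i) (x j)"
    then show "j = i \<or> j = (i + 1) mod n" using w(2)[OF i, of "x j"] j by (auto simp: S_def)
  next
    assume "j = i \<or> j = (i + 1) mod n"
    then have "x j \<in> F i" using xF[OF i j] by simp
    then show "R (w i) (x j)" using F_clique[OF i w(1)[OF i]] w_x[OF i j] by blast
  qed
  have own_rim: "\<exists>a<n. (a = i \<or> a = (i + 1) mod n) \<and> \<not> (a = j \<or> a = (j + 1) mod n)"
    if "i < n" "j < n" "i \<noteq> j" for i j
  proof (cases "i = (j + 1) mod n")
    case True
    then have "(i + 1) mod n < n" "(i + 1) mod n \<noteq> j" "(i + 1) mod n \<noteq> (j + 1) mod n"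
      using that n by (auto simp: Suc_mod split: if_splits)
    then show ?thesis by blast
  next
    case False then show ?thesis using that by blast
  qed
  have w_ne: "w i \<noteq> w j" if "i < n" "j < n" "i \<noteq> j" for i j
    using own_rim[OF that] w_adj that by metis
  have w_indep: "\<not> R (w i) (w j)" if ij: "i < n" "j < n" for i j
  proof (cases "i = j")
    case True then show ?thesis using irr by simp
  next
    case False
    obtain a where a: "a < n" "a = i \<or> a = (i + 1) mod n" "\<not> (a = j \<or> a = (j + 1) mod n)"
      using own_rim[OF ij False] by blast
    obtain b where b: "b < n" "b = j \<or> b = (j + 1) mod n" "\<not> (b = i \<or> b = (i + 1) mod n)"
      using own_rim[of j i] ij False by blast
    \<comment> \<open>If \<open>w i\<close> and \<open>w j\<close> were adjacent,
      \<open>w i\<close>, \<open>x a\<close>, \<open>x b\<close>, \<open>w j\<close> would be a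
      chordless 4-cycle.\<close>
    have "R (w i) (x a)" "\<not> R (w i) (x b)" "R (w j) (x b)" "\<not> R (w j) (x a)"
      using w_adj[OF ij(1)] w_adj[OF ij(2)] a b by auto
    moreover have "a \<noteq> b" using a b by blast
    then have "R (x a) (x b)" using x_clique a(1) b(1) by blast
    moreover have "w i \<noteq> x b" "x a \<noteq> w j" using w_x ij a(1) b(1) by (blast, metis)
    ultimately show ?thesis
      using hole_free_four_cycle[OF hf, of "w i" "x a" "x b" "w j"] sym by blast
  qed
  have "inj_on x {..<n}" "inj_on w {..<n}" using x_ne w_ne by (auto simp: inj_on_def)
  then have "induced_sun R n x w"
    unfolding induced_sun_def using w_x w_indep w_adj x_clique irr by blast
  then show ?thesis using n by blast
qed


section \<open>Induced cycles and suns as embeddings\<close>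

lemma has_induced_iff:
  "has_induced G H \<longleftrightarrow> (\<exists>f. inj_on f (verts H) \<and> f ` verts H \<subseteq> verts G \<and>
     (\<forall>x\<in>verts H. \<forall>y\<in>verts H. {x, y} \<in> edges H \<longleftrightarrow> {f x, f y} \<in> edges G))"
proof
  assume "has_induced G H"
  then obtain W g where W: "W \<subseteq> verts G" "bij_betw g W (verts H)"
    and g: "\<And>x y. x \<in> W \<Longrightarrow> y \<in> W \<Longrightarrow> {x, y} \<in> edges G \<longleftrightarrow> {g x, g y} \<in> edges H"
    by (auto simp: has_induced_def graph_iso_def induced_subgraph_def)
  let ?f = "inv_into W g"
  have f: "bij_betw ?f (verts H) W" using bij_betw_inv_into[OF W(2)] .
  have fW: "?f x \<in> W" "g (?f x) = x" if "x \<in> verts H" for x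
    using that bij_betwE[OF f] bij_betw_inv_into_right[OF W(2)] by auto
  show "\<exists>f. inj_on f (verts H) \<and> f ` verts H \<subseteq> verts G \<and>
     (\<forall>x\<in>verts H. \<forall>y\<in>verts H. {x, y} \<in> edges H \<longleftrightarrow> {f x, f y} \<in> edges G)"
  proof (intro exI[of _ ?f] conjI ballI)
    show "inj_on ?f (verts H)" using f by (simp add: bij_betw_def)
    show "?f ` verts H \<subseteq> verts G" using f W(1) by (auto simp: bij_betw_def)
    fix x y assume "x \<in> verts H" "y \<in> verts H"
    then show "{x, y} \<in> edges H \<longleftrightarrow> {?f x, ?f y} \<in> edges G"
      using g[of "?f x" "?f y"] fW by simp
  qed
next
  assume "\<exists>f. inj_on f (verts H) \<and> f ` verts H \<subseteq> verts G \<and>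
     (\<forall>x\<in>verts H. \<forall>y\<in>verts H. {x, y} \<in> edges H \<longleftrightarrow> {f x, f y} \<in> edges G)"
  then obtain f where f: "inj_on f (verts H)" "f ` verts H \<subseteq> verts G"
    "\<And>x y. x \<in> verts H \<Longrightarrow> y \<in> verts H \<Longrightarrow> {x, y} \<in> edges H \<longleftrightarrow> {f x, f y} \<in> edges G" by blast
  let ?W = "f ` verts H"
  let ?g = "inv_into (verts H) f"
  have "bij_betw ?g ?W (verts H)" using f(1) by (simp add: bij_betw_inv_into inj_on_imp_bij_betw)
  moreover have "{x, y} \<in> edges G \<longleftrightarrow> {?g x, ?g y} \<in> edges H" if "x \<in> ?W" "y \<in> ?W" for x y
    using f(3)[of "?g x" "?g y"] that by (simp add: inv_into_into f_inv_into_f)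
  ultimately have "graph_iso (induced_subgraph G ?W) H"
    by (auto simp: graph_iso_def induced_subgraph_def)
  then show "has_induced G H" using f(2) by (auto simp: has_induced_def)
qed

lemma edge_cycle_graph:
  assumes "i < n" "j < n"
  shows "{i, j} \<in> edges (cycle_graph n) \<longleftrightarrow> j = (i + 1) mod n \<or> i = (j + 1) mod n"
  using assms by (auto simp: cycle_graph_def doubleton_eq_iff)

lemma has_induced_cycle_iff:
  assumes "verts G = UNIV"
  shows "has_induced G (cycle_graph n) \<longleftrightarrow> (\<exists>f. induced_cycle (\<lambda>a b. {a, b} \<in> edges G) n f)"
proof -
  have "verts (cycle_graph n) = {..<n}" by (simp add: cycle_graph_def)
  then show ?thesis
    unfolding has_induced_iff induced_cycle_def using assms edge_cycle_graph[of _ n]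
    by (auto simp: Ball_def)
qed

lemma edge_sun_graph:
  assumes "i < n" "j < n"
  shows "{Inl i, Inl j} \<in> edges (sun_graph n) \<longleftrightarrow> i \<noteq> j"
    "{Inr i, Inl j} \<in> edges (sun_graph n) \<longleftrightarrow> j = i \<or> j = (i + 1) mod n"
    "{Inr i, Inr j} \<notin> edges (sun_graph n)"
proof -
  have "(\<exists>a b. {i, j} = {a, b} \<and> a < b \<and> b < n) \<longleftrightarrow> i \<noteq> j"
    using assms by (cases i j rule: linorder_cases) (auto simp: doubleton_eq_iff)
  then show "{Inl i, Inl j} \<in> edges (sun_graph n) \<longleftrightarrow> i \<noteq> j"
    by (auto simp: sun_graph_def doubleton_eq_iff)
qed (use assms in \<open>auto simp: sun_graph_def doubleton_eq_iff\<close>)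

lemma has_induced_sun_iff:
  assumes "verts G = UNIV"
  shows "has_induced G (sun_graph n) \<longleftrightarrow> (\<exists>u w. induced_sun (\<lambda>a b. {a, b} \<in> edges G) n u w)"
proof
  assume "has_induced G (sun_graph n)"
  then obtain f where f: "inj_on f (verts (sun_graph n))"
    "\<And>x y. x \<in> verts (sun_graph n) \<Longrightarrow> y \<in> verts (sun_graph n) \<Longrightarrow>
       {x, y} \<in> edges (sun_graph n) \<longleftrightarrow> {f x, f y} \<in> edges G"
    unfolding has_induced_iff by blast
  have V: "Inl i \<in> verts (sun_graph n)" "Inr i \<in> verts (sun_graph n)" if "i < n" for i
    using that by (auto simp: sun_graph_def)
  have "induced_sun (\<lambda>a b. {a, b} \<in> edges G) n (f \<circ> Inl) (f \<circ> Inr)"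
    unfolding induced_sun_def
  proof (intro conjI allI impI)
    show "inj_on (f \<circ> Inl) {..<n}" "inj_on (f \<circ> Inr) {..<n}"
      using inj_onD[OF f(1)] V by (auto intro!: inj_onI) (blast dest: inj_onD[OF f(1)])+
    fix i j assume ij: "i < n" "j < n"
    show "(f \<circ> Inr) i \<noteq> (f \<circ> Inl) j" using inj_onD[OF f(1)] V ij by fastforce
    show "{(f \<circ> Inr) i, (f \<circ> Inr) j} \<notin> edges G"
      "{(f \<circ> Inl) i, (f \<circ> Inl) j} \<in> edges G \<longleftrightarrow> i \<noteq> j"
      "{(f \<circ> Inr) i, (f \<circ> Inl) j} \<in> edges G \<longleftrightarrow> j = i \<or> j = (i + 1) mod n"
      using f(2)[OF V(2)[OF ij(1)] V(2)[OF ij(2)]] f(2)[OF V(1)[OF ij(1)] V(1)[OF ij(2)]]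
        f(2)[OF V(2)[OF ij(1)] V(1)[OF ij(2)]] edge_sun_graph[OF ij] by simp_all
  qed
  then show "\<exists>u w. induced_sun (\<lambda>a b. {a, b} \<in> edges G) n u w" by blast
next
  assume "\<exists>u w. induced_sun (\<lambda>a b. {a, b} \<in> edges G) n u w"
  then obtain u w where uw: "induced_sun (\<lambda>a b. {a, b} \<in> edges G) n u w" by blast
  have V: "verts (sun_graph n) = Inl ` {..<n} \<union> Inr ` {..<n}" by (simp add: sun_graph_def)
  have inj: "inj_on (case_sum u w) (verts (sun_graph n))"
    unfolding V inj_on_def using uw by (auto simp: induced_sun_def inj_on_def) metis+
  have edge: "{x, y} \<in> edges (sun_graph n) \<longleftrightarrow> {case_sum u w x, case_sum u w y} \<in> edges G"
    if xy: "x \<in> verts (sun_graph n)" "y \<in> verts (sun_graph n)" for x y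
  proof -
    have *: "{u i, u j} \<in> edges G \<longleftrightarrow> i \<noteq> j" "{w i, w j} \<notin> edges G"
      "{w i, u j} \<in> edges G \<longleftrightarrow> j = i \<or> j = (i + 1) mod n" if "i < n" "j < n" for i j
      using uw that by (auto simp: induced_sun_def)
    consider i j where "x = Inl i" "y = Inl j" "i < n" "j < n" | i j where "x = Inr i" "y = Inr j" "i < n" "j < n"
      | i j where "x = Inr i" "y = Inl j" "i < n" "j < n" | i j where "x = Inl j" "y = Inr i" "i < n" "j < n"
      using xy unfolding V by blast
    then show ?thesis
    proof cases
      case 1 then show ?thesis using *(1) edge_sun_graph(1)[of i n j] by simp
    next
      case 2 then show ?thesis using *(2) edge_sun_graph(3)[of i n j] by simp
    next
      case 3 then show ?thesis using *(3) edge_sun_graph(2)[of i n j] by simp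
    next
      case 4 then show ?thesis using *(3) edge_sun_graph(2)[of i n j] by (simp add: insert_commute)
    qed
  qed
  show "has_induced G (sun_graph n)"
    unfolding has_induced_iff using inj edge assms(1) by (intro exI[of _ "case_sum u w"]) auto
qed

context
  fixes G :: "'n::finite graph" and E :: "'n \<Rightarrow> 'n \<Rightarrow> bool"
  assumes simple: "finite_simple_graph G" and spanning: "verts G = UNIV"
    and E_iff: "\<And>a b. E a b \<longleftrightarrow> {a, b} \<in> edges G"
begin

lemma adjacency_symp_irreflp: "symp E" "irreflp E"
  using simple unfolding E_iff by (auto intro!: sympI irreflpI simp: E_iff insert_commute finite_simple_graph_def)

lemma strongly_chordal_iff_hole_free_sun_free:
  "strongly_chordal G \<longleftrightarrow> hole_free E \<and> \<not> (\<exists>n\<ge>3. \<exists>u w. induced_sun E n u w)"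
proof -
  have E_eq: "E = (\<lambda>a b. {a, b} \<in> edges G)" by (intro ext E_iff)
  show ?thesis
    unfolding strongly_chordal_def chordal_def hole_free_def has_induced_cycle_iff[OF spanning]
      has_induced_sun_iff[OF spanning] E_eq ..
qed

lemma mat_labeling_if_strongly_chordal:
  assumes "strongly_chordal G"
  shows "\<exists>L. mat_labeling E L \<and>
    (\<forall>a b k. E a b \<longrightarrow> k \<le> L a b \<longrightarrow> (\<exists>c d. E c d \<and> L c d = k))"
proof -
  note E = adjacency_symp_irreflp
  have "totally_balanced (maximal_cliques E)"
    using special_cycle_if_not_totally_balanced induced_sun_if_special_cycle[OF _ E] assms
    unfolding strongly_chordal_iff_hole_free_sun_free by blast
  from totally_balanced_labeling[OF _ this, of UNIV] show ?thesis
    unfolding comembers_maximal_cliques[OF E] by auto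
qed

lemma strongly_chordal_if_mat_labeling:
  assumes "mat_labeling E L"
  shows "strongly_chordal G"
proof -
  interpret mat_labeling E L by (rule assms)
  have "\<not> induced_sun E n u w" if "n \<ge> 3" for n u w
    using no_sun[OF that, of u w] unfolding induced_sun_def by blast
  then show ?thesis using strongly_chordal_iff_hole_free_sun_free hole_free_E by blast
qed

end

section \<open>Graphic arrangements\<close>

definition hyp :: "'n \<Rightarrow> 'n \<Rightarrow> ('k::field ^ 'n::finite) set" where
  "hyp a b = {x. x $ a - x $ b = 0}"

lemma hyp_commute: "hyp a b = hyp b a"
  by (auto simp: hyp_def)

lemma subspace_hyp: "vec.subspace (hyp a b)"
  by (auto simp: hyp_def vec.subspace_def algebra_simps)

section \<open>Rank and independence of hyperplanes\<close>

lemma vec_dim_le_card: "vec.dim S \<le> CARD('n)" for S :: "('k::field ^ 'n::finite) set"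
  using vec.dim_subset[of S UNIV] unfolding vec_dim_card by simp

lemma dim_Int_hyperplane:
  fixes S H :: "('k::field ^ 'n::finite) set"
  assumes S: "vec.subspace S" and H: "linear_hyperplane H" and "\<not> S \<subseteq> H"
  shows "vec.dim (S \<inter> H) + 1 = vec.dim S"
proof -
  have subH: "vec.subspace H" and dimH: "vec.dim H + 1 = CARD('n)"
    using H by (auto simp: linear_hyperplane_def codim_def)
  let ?T = "{x + y |x y. x \<in> S \<and> y \<in> H}"
  have T: "vec.subspace ?T" using vec.subspace_sums[OF S subH] .
  have sub: "H \<subseteq> ?T" "S \<subseteq> ?T"
    using vec.subspace_0[OF S] vec.subspace_0[OF subH] by force+
  have "H \<noteq> ?T" using assms(3) sub(2) by blast
  then have "vec.dim H < vec.dim ?T"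
    using vec.subspace_dim_equal[OF subH T sub(1)] by linarith
  moreover have "vec.dim ?T \<le> CARD('n)"
    by (rule vec_dim_le_card)
  ultimately have "vec.dim ?T = CARD('n)" using dimH by linarith
  then show ?thesis using vec.dim_sums_Int[OF S subH] dimH by linarith
qed

lemma hyperplane_hyp:
  assumes "a \<noteq> b"
  shows "linear_hyperplane (hyp a b :: ('k::field ^ 'n::finite) set)"
proof -
  let ?H = "hyp a b :: ('k ^ 'n) set"
  let ?e = "axis a 1 :: 'k ^ 'n"
  have e: "?e \<notin> ?H" using assms by (simp add: hyp_def axis_def)
  have "x \<in> vec.span (insert ?e ?H)" for x
  proof -
    let ?c = "x $ a - x $ b"
    have "x - ?c *s ?e \<in> ?H" using assms by (simp add: hyp_def axis_def)
    then have "x - ?c *s ?e \<in> vec.span ?H" by (rule vec.span_base)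
    then show ?thesis unfolding vec.span_insert by blast
  qed
  then have "vec.dim (insert ?e ?H) = CARD('n)"
    by (metis UNIV_eq_I vec.dim_span vec_dim_card)
  moreover have "vec.span ?H = ?H" using subspace_hyp by (simp add: vec.span_eq_iff)
  ultimately have "vec.dim ?H + 1 = CARD('n)" using e vec.dim_insert[of ?e ?H] by simp
  then have "CARD('n) - vec.dim ?H = 1" by linarith
  then show ?thesis unfolding linear_hyperplane_def codim_def using subspace_hyp by blast
qed

lemma subspace_Inter_hyperplanes:
  "(\<And>H. H \<in> B \<Longrightarrow> linear_hyperplane H) \<Longrightarrow> vec.subspace (\<Inter>B)"
  by (rule vec.subspace_Inter) (auto simp: linear_hyperplane_def)

lemma arr_rank_le_card:
  fixes B :: "('k::field ^ 'n::finite) set set"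
  assumes "finite B" "\<And>H. H \<in> B \<Longrightarrow> linear_hyperplane H"
  shows "CARD('n) \<le> vec.dim (\<Inter>B) + card B"
  using assms
proof (induction B rule: finite_induct)
  case empty
  then show ?case by (simp only: Inter_empty vec_dim_card card.empty)
next
  case (insert H B)
  have "vec.dim (\<Inter>B) \<le> vec.dim (\<Inter>B \<inter> H) + 1"
  proof (cases "\<Inter>B \<subseteq> H")
    case True then show ?thesis by (simp add: inf.absorb1)
  next
    case False
    then show ?thesis
      using dim_Int_hyperplane[OF subspace_Inter_hyperplanes[of B], of H] insert.prems by simp
  qed
  then show ?case using insert by (simp add: inf_commute)
qed

text \<open>Each hyperplane lowers the dimension of an intersection by at most one, and full rank
  means that each of them does. The right-hand side is linear independence of the defining
  forms.\<close>

lemma arr_rank_eq_card_iff: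
  fixes B :: "('k::field ^ 'n::finite) set set"
  assumes fin: "finite B" and hyp: "\<And>H. H \<in> B \<Longrightarrow> linear_hyperplane H"
  shows "arr_rank B = card B \<longleftrightarrow> (\<forall>H\<in>B. \<not> \<Inter>(B - {H}) \<subseteq> H)"
proof -
  have rank_iff: "arr_rank B = card B \<longleftrightarrow> vec.dim (\<Inter>B) + card B = CARD('n)"
    using vec_dim_le_card[of "\<Inter>B"] arr_rank_le_card[OF assms] by (auto simp: arr_rank_def codim_def)
  show ?thesis
  proof
    assume rank: "arr_rank B = card B"
    show "\<forall>H\<in>B. \<not> \<Inter>(B - {H}) \<subseteq> H"
    proof (intro ballI notI)
      fix H assume H: "H \<in> B" "\<Inter>(B - {H}) \<subseteq> H"
      then have "\<Inter>B = \<Inter>(B - {H})" by blast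
      moreover have "CARD('n) \<le> vec.dim (\<Inter>(B - {H})) + card (B - {H})"
        using arr_rank_le_card[of "B - {H}"] assms by blast
      moreover have "card (B - {H}) < card B" using H(1) fin by (intro card_Diff1_less) auto
      ultimately show False using rank rank_iff by simp
    qed
  next
    assume ind: "\<forall>H\<in>B. \<not> \<Inter>(B - {H}) \<subseteq> H"
    have "vec.dim (\<Inter>C) + card C = CARD('n)" if "C \<subseteq> B" for C
      using finite_subset[OF that fin] that
    proof (induction C rule: finite_induct)
      case empty
      then show ?case by (simp only: Inter_empty vec_dim_card card.empty)
    next
      case (insert H C)
      have "\<Inter>(B - {H}) \<subseteq> \<Inter>C" using insert.hyps insert.prems by blast
      moreover have "\<not> \<Inter>(B - {H}) \<subseteq> H" using ind insert.prems by simp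
      ultimately have "\<not> \<Inter>C \<subseteq> H" using subset_trans by metis
      then have "vec.dim (\<Inter>C \<inter> H) + 1 = vec.dim (\<Inter>C)"
        using dim_Int_hyperplane[OF subspace_Inter_hyperplanes[of C], of H] insert.prems hyp by (metis insert_subset subsetD)
      then show ?case using insert by (simp add: inf_commute)
    qed
    then show "arr_rank B = card B" using rank_iff by simp
  qed
qed

text \<open>The intersection consists of the vectors that are constant on the components of
  \<open>R\<close>. If \<open>v\<close> is not reachable from \<open>u\<close>, the indicator vector
  of the component of \<open>u\<close> separates the two sides.\<close>

lemma Inter_hyp_subset_iff:
  assumes "symp R"
  shows "\<Inter>{hyp a b | a b. R a b} \<subseteq> (hyp u v :: ('k::field ^ 'n::finite) set) \<longleftrightarrow> R\<^sup>*\<^sup>* u v"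
proof
  assume sub: "\<Inter>{hyp a b | a b. R a b} \<subseteq> (hyp u v :: ('k ^ 'n) set)"
  let ?x = "\<chi> i. if R\<^sup>*\<^sup>* u i then 1 else (0 :: 'k)"
  have "R\<^sup>*\<^sup>* u a \<longleftrightarrow> R\<^sup>*\<^sup>* u b" if "R a b" for a b
    using that sympD[OF assms that] by (meson rtranclp.rtrancl_into_rtrancl)
  then have "?x \<in> \<Inter>{hyp a b | a b. R a b}" by (auto simp: hyp_def)
  then have "?x \<in> hyp u v" using sub by blast
  then show "R\<^sup>*\<^sup>* u v" by (simp add: hyp_def split: if_splits)
next
  assume "R\<^sup>*\<^sup>* u v"
  then show "\<Inter>{hyp a b | a b. R a b} \<subseteq> (hyp u v :: ('k ^ 'n) set)"
  proof (induction rule: rtranclp_induct)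
    case base then show ?case by (auto simp: hyp_def)
  next
    case (step b c)
    have "x \<in> hyp u c" if "x \<in> \<Inter>{hyp a b | a b. R a b}" for x :: "'k ^ 'n"
    proof -
      have "x \<in> hyp b c" "x \<in> hyp u b" using that step by blast+
      then show ?thesis by (simp add: hyp_def)
    qed
    then show ?case by blast
  qed
qed

text \<open>The indicator vector of \<open>S\<close> is the test vector; small sets \<open>S\<close>
  reveal which coordinates an inclusion forces to be equal.\<close>

lemma hyp_Int_subset_imp:
  assumes sub: "hyp a b \<inter> hyp u v \<subseteq> (hyp c d :: ('k::field ^ 'n::finite) set)"
    and S: "c \<in> S" "a \<in> S \<longleftrightarrow> b \<in> S" "u \<in> S \<longleftrightarrow> v \<in> S"
  shows "d \<in> S"
proof -
  let ?x = "\<chi> i. if i \<in> S then 1 else (0 :: 'k)"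
  have "?x \<in> hyp a b \<inter> hyp u v" using S by (simp add: hyp_def)
  then have "?x \<in> hyp c d" using sub by blast
  then show ?thesis using S(1) by (simp add: hyp_def split: if_splits)
qed

lemma hyp_eq_iff:
  assumes "a \<noteq> b" "c \<noteq> d"
  shows "(hyp a b :: ('k::field ^ 'n::finite) set) = hyp c d \<longleftrightarrow> {a, b} = {c, d}"
proof
  assume "(hyp a b :: ('k ^ 'n) set) = hyp c d"
  then have sub: "hyp a b \<inter> hyp a b \<subseteq> (hyp c d :: ('k ^ 'n) set)"
      "hyp a b \<inter> hyp a b \<subseteq> (hyp d c :: ('k ^ 'n) set)" using hyp_commute[of c d] by auto
  have "c \<in> {a, b}" using hyp_Int_subset_imp[OF sub(1), of "{c}"] assms by auto
  moreover have "d \<in> {a, b}" using hyp_Int_subset_imp[OF sub(2), of "{d}"] assms by auto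
  ultimately show "{a, b} = {c, d}" using assms by auto
next
  assume "{a, b} = {c, d}"
  then show "(hyp a b :: ('k ^ 'n) set) = hyp c d" using hyp_commute by (auto simp: doubleton_eq_iff)
qed

section \<open>Families of graphic hyperplanes and their restrictions\<close>

definition hyps :: "('n \<Rightarrow> 'n \<Rightarrow> bool) \<Rightarrow> ('k::field ^ 'n::finite) set set" where
  "hyps R = {hyp a b | a b. R a b}"

lemma finite_hyps: "finite (hyps R)"
proof -
  have "hyps R \<subseteq> (\<lambda>(a, b). hyp a b) ` UNIV" by (auto simp: hyps_def)
  then show ?thesis by (rule finite_subset) simp
qed

lemma hyp_in_hyps_iff:
  assumes "symp R" "irreflp R" "a \<noteq> b"
  shows "(hyp a b :: ('k::field ^ 'n::finite) set) \<in> hyps R \<longleftrightarrow> R a b"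
proof
  assume "(hyp a b :: ('k ^ 'n) set) \<in> hyps R"
  then obtain c d where cd: "hyp a b = (hyp c d :: ('k ^ 'n) set)" "R c d" by (auto simp: hyps_def)
  then have "c \<noteq> d" using assms(2) by (auto dest: irreflpD)
  then have "{a, b} = {c, d}" using cd(1) hyp_eq_iff[OF assms(3), where 'k = 'k] by blast
  then show "R a b" using cd(2) sympD[OF assms(1) cd(2)] by (auto simp: doubleton_eq_iff)
qed (auto simp: hyps_def)

text \<open>Different hyperplanes can agree on \<open>hyp u v\<close> only if their edges complete a
  triangle on \<open>u\<close> and \<open>v\<close>. If \<open>{a, b}\<close> misses
  \<open>{u, v}\<close>, the equations identify only \<open>a\<close> with \<open>b\<close> and
  \<open>u\<close> with \<open>v\<close>, so \<open>{c, d}\<close> would be one of these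
  pairs.\<close>

lemma hyp_Int_eq_imp:
  assumes eq: "hyp a b \<inter> hyp u v = (hyp c d \<inter> hyp u v :: ('k::field ^ 'n::finite) set)"
    and ne: "a \<noteq> b" "c \<noteq> d" "u \<noteq> v" "{a, b} \<noteq> {u, v}" "{c, d} \<noteq> {u, v}" "{a, b} \<noteq> {c, d}"
  shows "\<exists>w. {a, b} = {u, w} \<and> {c, d} = {v, w} \<or> {a, b} = {v, w} \<and> {c, d} = {u, w}"
proof -
  have sub: "hyp a b \<inter> hyp u v \<subseteq> (hyp c d :: ('k ^ 'n) set)"
      "hyp a b \<inter> hyp u v \<subseteq> (hyp d c :: ('k ^ 'n) set)"
    using eq hyp_commute[of c d] by auto
  have cd: "c \<in> {a, b, u, v}" "d \<in> {a, b, u, v}"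
    using hyp_Int_subset_imp[OF sub(1), of "{c}"] hyp_Int_subset_imp[OF sub(2), of "{d}"] ne by auto
  show ?thesis
  proof (cases "{a, b} \<inter> {u, v} = {}")
    case True
    have "d \<in> {a, b}" if "c \<in> {a, b}"
      using hyp_Int_subset_imp[OF sub(1), of "{a, b}"] that True by auto
    moreover have "d \<in> {u, v}" if "c \<in> {u, v}"
      using hyp_Int_subset_imp[OF sub(1), of "{u, v}"] that True by auto
    ultimately show ?thesis using cd ne by auto
  next
    case False
    then obtain w where w: "{a, b} = {u, w} \<or> {a, b} = {v, w}" by auto
    have "{a, b, u, v} = {u, v, w}" using w by auto
    then have "c \<in> {u, v, w}" "d \<in> {u, v, w}" using cd by auto
    then have "{c, d} = {u, w} \<or> {c, d} = {v, w}"
      using ne(2,5) by (auto simp: doubleton_eq_iff)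
    then show ?thesis using w ne(6) by metis
  qed
qed

text \<open>Restriction to \<open>hyp u v\<close> identifies \<open>hyp u w\<close> with
  \<open>hyp v w\<close> for each common neighbour \<open>w\<close> and identifies nothing else, so
  the defect in (MP3) counts triangles.\<close>

lemma card_restriction_hyp:
  fixes u v :: "'n::finite"
  assumes R: "symp R" "irreflp R" and uv: "u \<noteq> v" "\<not> R u v"
  defines "B \<equiv> hyps R :: ('k::field ^ 'n) set set"
  shows "card (restriction (B \<union> {hyp u v}) (hyp u v)) + card {w. R u w \<and> R v w} = card B"
proof -
  let ?H = "hyp u v :: ('k ^ 'n) set"
  have sym: "R a b \<longleftrightarrow> R b a" for a b using R(1) by (auto dest: sympD)
  have ne: "a \<noteq> b" if "R a b" for a b using R(2) that by (auto dest: irreflpD)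
  have R_cong: "R c d" if "R a b" "{a, b} = {c, d}" for a b c d
    using that sym by (auto simp: doubleton_eq_iff)
  have finB: "finite B" by (simp add: B_def finite_hyps)
  have hB: "\<exists>a b. K = hyp a b \<and> R a b" if "K \<in> B" for K using that by (auto simp: B_def hyps_def)
  have mem: "hyp a b \<in> B \<longleftrightarrow> R a b" if "a \<noteq> b" for a b
    unfolding B_def using R that by (rule hyp_in_hyps_iff)
  have "?H \<notin> B" using mem uv by blast
  then have restr: "restriction (B \<union> {?H}) ?H = (\<lambda>K. K \<inter> ?H) ` B"
    by (auto simp: restriction_def)
  define W where "W = {w. R u w \<and> R v w}"
  \<comment> \<open>\<open>T\<close> contains one hyperplane of each identified pair.\<close>
  define T where "T = (hyp v ` W :: ('k ^ 'n) set set)"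
  have T_B: "T \<subseteq> B" using mem ne by (auto simp: T_def W_def)
  have "inj_on (hyp v :: 'n \<Rightarrow> ('k ^ 'n) set) W"
  proof (rule inj_onI)
    fix w w' assume "w \<in> W" "w' \<in> W" "hyp v w = (hyp v w' :: ('k ^ 'n) set)"
    then show "w = w'" using hyp_eq_iff[of v w v w', where 'k = 'k] ne by (auto simp: W_def doubleton_eq_iff)
  qed
  then have card_T: "card T = card W" by (simp add: T_def card_image)
  have "(\<lambda>K. K \<inter> ?H) ` B = (\<lambda>K. K \<inter> ?H) ` (B - T)"
  proof (intro equalityI subsetI)
    fix X assume "X \<in> (\<lambda>K. K \<inter> ?H) ` B"
    then obtain K where K: "K \<in> B" "X = K \<inter> ?H" by blast
    show "X \<in> (\<lambda>K. K \<inter> ?H) ` (B - T)"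
    proof (cases "K \<in> T")
      case True
      then obtain w where w: "R u w" "R v w" "K = hyp v w" by (auto simp: T_def W_def)
      have "hyp u w \<notin> T"
      proof
        assume "hyp u w \<in> T"
        then obtain w' where w': "R u w'" "R v w'" "hyp u w = (hyp v w' :: ('k ^ 'n) set)"
          by (auto simp: T_def W_def)
        then have "{u, w} = {v, w'}" using hyp_eq_iff[of u w v w', where 'k = 'k] ne w by auto
        then show False using uv w' ne by (auto simp: doubleton_eq_iff)
      qed
      moreover have "hyp u w \<in> B" using mem ne w by blast
      moreover have "X = hyp u w \<inter> ?H" using K w by (auto simp: hyp_def)
      ultimately show ?thesis by blast
    next
      case False then show ?thesis using K by blast
    qed
  qed auto
  moreover have "inj_on (\<lambda>K. K \<inter> ?H) (B - T)"
  proof (rule inj_onI, rule ccontr)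
    fix K K' assume K: "K \<in> B - T" "K' \<in> B - T" "K \<inter> ?H = K' \<inter> ?H" "K \<noteq> K'"
    obtain a b where ab: "K = hyp a b" "R a b" using K(1) hB[of K] by auto
    obtain c d where cd: "K' = hyp c d" "R c d" using K(2) hB[of K'] by auto
    have "\<exists>w. {a, b} = {u, w} \<and> {c, d} = {v, w} \<or> {a, b} = {v, w} \<and> {c, d} = {u, w}"
    proof (rule hyp_Int_eq_imp[where 'k = 'k])
      show "hyp a b \<inter> hyp u v = (hyp c d \<inter> hyp u v :: ('k ^ 'n) set)" using K ab cd by simp
      show "{a, b} \<noteq> {u, v}" "{c, d} \<noteq> {u, v}" using R_cong ab cd uv by blast+
      show "{a, b} \<noteq> {c, d}" using K(4) ab cd hyp_eq_iff[of a b c d, where 'k = 'k] ne by blast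
    qed (use ne ab cd uv in auto)
    then obtain w where w: "{a, b} = {u, w} \<and> {c, d} = {v, w} \<or> {a, b} = {v, w} \<and> {c, d} = {u, w}" by blast
    then have "R u w" "R v w" using R_cong ab cd by blast+
    then have "hyp v w \<in> T" by (auto simp: T_def W_def)
    moreover have "K = hyp v w \<or> K' = hyp v w"
      using w ab cd hyp_eq_iff[of a b v w, where 'k = 'k] hyp_eq_iff[of c d v w, where 'k = 'k]
        ne[OF ab(2)] ne[OF cd(2)] ne[OF \<open>R v w\<close>] by blast
    ultimately show False using K by blast
  qed
  ultimately have "card (restriction (B \<union> {?H}) ?H) = card (B - T)"
    unfolding restr by (simp add: card_image)
  moreover have "card (B - T) + card T = card B"
    using finB T_B by (simp add: card_Diff_subset finite_subset card_mono)
  ultimately show ?thesis using card_T by (simp add: W_def)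
qed

section \<open>MAT-partitions and MAT-labelings\<close>

definition MAT_block ::
    "('n \<Rightarrow> 'n \<Rightarrow> bool) \<Rightarrow> ('n \<Rightarrow> 'n \<Rightarrow> nat) \<Rightarrow> nat \<Rightarrow> ('k::field ^ 'n::finite) set set" where
  "MAT_block E L k = hyps (\<lambda>a b. E a b \<and> L a b = k)"

definition MAT_lower ::
    "('n \<Rightarrow> 'n \<Rightarrow> bool) \<Rightarrow> ('n \<Rightarrow> 'n \<Rightarrow> nat) \<Rightarrow> nat \<Rightarrow> ('k::field ^ 'n::finite) set set" where
  "MAT_lower E L k = hyps (\<lambda>a b. E a b \<and> L a b < k)"

text \<open>The conditions on a block are stated for every natural \<open>k\<close>, also past the
  last block. The type argument fixes the field, which \<open>E\<close> and \<open>L\<close> do not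
  mention.\<close>

definition MAT_conditions :: "('n::finite \<Rightarrow> 'n \<Rightarrow> bool) \<Rightarrow> ('n \<Rightarrow> 'n \<Rightarrow> nat) \<Rightarrow> 'k::field itself \<Rightarrow> nat \<Rightarrow> bool" where
  "MAT_conditions E L _ k \<longleftrightarrow> (let P = MAT_block E L k :: ('k ^ 'n) set set; B = MAT_lower E L k in
     arr_rank P = card P \<and> \<not> (\<exists>H'\<in>B. \<Inter>P \<subseteq> H') \<and>
     (\<forall>H\<in>P. int (card B) - int (card (restriction (B \<union> {H}) H)) = int k))"

text \<open>(MP1) becomes acyclicity through \<open>arr_rank_eq_card_iff\<close> and
  \<open>Inter_hyp_subset_iff\<close>, (MP2) becomes closure by the latter alone, and (MP3) is
  \<open>card_restriction_hyp\<close> for the edges of smaller label.\<close>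

lemma MAT_conditions_iff:
  fixes E :: "'n::finite \<Rightarrow> 'n \<Rightarrow> bool"
  assumes E: "symp E" "irreflp E" and L: "\<And>a b. L a b = L b a"
  shows "MAT_conditions E L TYPE('k::field) k \<longleftrightarrow>
    (\<forall>u v. E u v \<and> L u v = k \<longrightarrow> \<not> (\<lambda>a b. E a b \<and> L a b = L u v \<and> {a, b} \<noteq> {u, v})\<^sup>*\<^sup>* u v) \<and>
    (\<forall>u v. E u v \<and> L u v < k \<longrightarrow> \<not> (\<lambda>a b. E a b \<and> L a b = k)\<^sup>*\<^sup>* u v) \<and>
    (\<forall>u v. E u v \<and> L u v = k \<longrightarrow> card {w. E u w \<and> E v w \<and> L u w < L u v \<and> L v w < L u v} = L u v)"
    (is "_ \<longleftrightarrow> ?acyclic \<and> ?closed \<and> ?count")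
proof -
  let ?P = "MAT_block E L k :: ('k ^ 'n) set set" and ?B = "MAT_lower E L k :: ('k ^ 'n) set set"
  have ne: "a \<noteq> b" if "E a b" for a b using E(2) that by (auto dest: irreflpD)
  have comm: "E a b \<and> L a b = l \<longleftrightarrow> E b a \<and> L b a = l" for a b l
    using sympD[OF E(1), of a b] sympD[OF E(1), of b a] L[of a b] by auto
  have sym: "symp (\<lambda>a b. E a b \<and> L a b = k)" "symp (\<lambda>a b. E a b \<and> L a b < k)"
    by (rule sympI; metis comm)+
  have irr: "irreflp (\<lambda>a b. E a b \<and> L a b < k)"
    using ne by (auto intro: irreflpI)
  have hyper: "linear_hyperplane H" if "H \<in> ?P" for H
    using that hyperplane_hyp ne by (auto simp: MAT_block_def hyps_def)
  have diff: "?P - {hyp u v} = hyps (\<lambda>a b. E a b \<and> L a b = k \<and> {a, b} \<noteq> {u, v})" if uv: "E u v" for u v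
  proof -
    have "hyp a b \<noteq> (hyp u v :: ('k ^ 'n) set) \<longleftrightarrow> {a, b} \<noteq> {u, v}" if "E a b" for a b
      using hyp_eq_iff[OF ne[OF that] ne[OF uv], where 'k = 'k] by simp
    then have *: "X \<in> ?P \<and> X \<noteq> hyp u v \<longleftrightarrow> (\<exists>a b. X = hyp a b \<and> E a b \<and> L a b = k \<and> {a, b} \<noteq> {u, v})" for X
      unfolding MAT_block_def hyps_def mem_Collect_eq by metis
    show ?thesis
      unfolding hyps_def[of "\<lambda>a b. E a b \<and> L a b = k \<and> {a, b} \<noteq> {u, v}"]
      by (intro set_eqI) (simp only: Diff_iff singleton_iff mem_Collect_eq *)
  qed
  have "arr_rank ?P = card ?P \<longleftrightarrow> (\<forall>H\<in>?P. \<not> \<Inter>(?P - {H}) \<subseteq> H)"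
    using hyper by (intro arr_rank_eq_card_iff) (simp_all add: MAT_block_def finite_hyps)
  also have "\<dots> \<longleftrightarrow> (\<forall>u v. E u v \<and> L u v = k \<longrightarrow> \<not> \<Inter>(?P - {hyp u v}) \<subseteq> hyp u v)"
    unfolding MAT_block_def hyps_def by blast
  also have "\<dots> \<longleftrightarrow> ?acyclic"
  proof -
    have "\<Inter>(?P - {hyp u v}) \<subseteq> hyp u v \<longleftrightarrow> (\<lambda>a b. E a b \<and> L a b = L u v \<and> {a, b} \<noteq> {u, v})\<^sup>*\<^sup>* u v"
      if uv: "E u v" "L u v = k" for u v
    proof -
      have "symp (\<lambda>a b. E a b \<and> L a b = k \<and> {a, b} \<noteq> {u, v})"
        by (rule sympI) (metis comm insert_commute)
      then show ?thesis
        unfolding diff[OF uv(1)] hyps_def uv(2) by (rule Inter_hyp_subset_iff)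
    qed
    then show ?thesis by blast
  qed
  finally have 1: "arr_rank ?P = card ?P \<longleftrightarrow> ?acyclic" .
  have "\<Inter>?P \<subseteq> hyp u v \<longleftrightarrow> (\<lambda>a b. E a b \<and> L a b = k)\<^sup>*\<^sup>* u v" for u v
    unfolding MAT_block_def hyps_def using sym(1) by (rule Inter_hyp_subset_iff)
  then have 2: "\<not> (\<exists>H'\<in>?B. \<Inter>?P \<subseteq> H') \<longleftrightarrow> ?closed"
    unfolding MAT_lower_def hyps_def by blast
  have count: "int (card ?B) - int (card (restriction (?B \<union> {hyp u v}) (hyp u v))) = int k \<longleftrightarrow>
      card {w. E u w \<and> E v w \<and> L u w < L u v \<and> L v w < L u v} = L u v" if uv: "E u v" "L u v = k" for u v
  proof -
    let ?R = "\<lambda>a b. E a b \<and> L a b < k"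
    have "card (restriction (?B \<union> {hyp u v}) (hyp u v)) + card {w. ?R u w \<and> ?R v w} = card ?B"
      unfolding MAT_lower_def
      by (rule card_restriction_hyp[OF sym(2) irr ne[OF uv(1)]]) (simp add: uv)
    moreover have "{w. ?R u w \<and> ?R v w} = {w. E u w \<and> E v w \<and> L u w < L u v \<and> L v w < L u v}"
      using uv by auto
    ultimately have "int (card ?B) = int (card (restriction (?B \<union> {hyp u v}) (hyp u v))) +
        int (card {w. E u w \<and> E v w \<and> L u w < L u v \<and> L v w < L u v})" by simp
    then show ?thesis using uv(2) by linarith
  qed
  have 3: "(\<forall>H\<in>?P. int (card ?B) - int (card (restriction (?B \<union> {H}) H)) = int k) \<longleftrightarrow> ?count"
  proof -
    have "(\<forall>H\<in>?P. Q H) \<longleftrightarrow> (\<forall>u v. E u v \<and> L u v = k \<longrightarrow> Q (hyp u v))" for Q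
      by (auto simp: MAT_block_def hyps_def)
    then show ?thesis using count by presburger
  qed
  show ?thesis unfolding MAT_conditions_def Let_def 1 2 3 by blast
qed

lemma mat_labeling_iff_MAT_conditions:
  fixes E :: "'n::finite \<Rightarrow> 'n \<Rightarrow> bool"
  assumes E: "symp E" "irreflp E" and L: "\<And>a b. L a b = L b a"
  shows "mat_labeling E L \<longleftrightarrow> (\<forall>k. MAT_conditions E L TYPE('k::field) k)"
  unfolding MAT_conditions_iff[OF assms] mat_labeling_def using assms by (simp add: all_conj_distrib) blast

text \<open>Past the last block the intersection is the whole space, which no hyperplane contains.
  This bridges the finitely many blocks of a partition and the conditions for all \<open>k\<close>
  in a labeling.\<close>

lemma MAT_conditions_trivial:
  fixes E :: "'n::finite \<Rightarrow> 'n \<Rightarrow> bool"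
  assumes "\<And>a b. E a b \<Longrightarrow> L a b < k" and "irreflp E"
  shows "MAT_conditions E L TYPE('k::field) k"
proof -
  have "MAT_block E L k = ({} :: ('k ^ 'n) set set)" using assms(1) by (force simp: MAT_block_def hyps_def)
  moreover have "H \<noteq> UNIV" if H: "H \<in> (MAT_lower E L k :: ('k ^ 'n) set set)" for H
  proof -
    obtain a b where ab: "E a b" "H = hyp a b" using H by (auto simp: MAT_lower_def hyps_def)
    then have "a \<noteq> b" using assms(2) by (auto dest: irreflpD)
    then have "axis a 1 \<notin> H" using ab by (simp add: hyp_def axis_def)
    then show ?thesis by blast
  qed
  ultimately show ?thesis
    by (auto simp: MAT_conditions_def arr_rank_def codim_def vec_dim_card simp del: vec.dim_UNIV)
qed

lemma MAT_partition_imp_mat_labeling: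
  fixes E :: "'n::finite \<Rightarrow> 'n \<Rightarrow> bool" and \<pi> :: "('k::field ^ 'n) set set list"
  assumes E: "symp E" "irreflp E" and \<pi>: "MAT_partition (hyps E) \<pi>"
  shows "\<exists>L. mat_labeling E L"
proof -
  have part: "partition_on (hyps E) (set \<pi>)" and dist: "distinct \<pi>" using \<pi> by (auto simp: MAT_partition_def)
  have un: "\<Union>(set \<pi>) = hyps E" using part by (auto simp: partition_on_def)
  have uniq: "i = j" if "i < length \<pi>" "j < length \<pi>" "H \<in> \<pi> ! i" "H \<in> \<pi> ! j" for i j H
  proof -
    have "\<pi> ! i = \<pi> ! j"
      using part that unfolding partition_on_def disjoint_def by (metis IntI empty_iff nth_mem)
    then show ?thesis using dist that by (simp add: nth_eq_iff_index_eq)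
  qed
  \<comment> \<open>On pairs that are not edges the description may denote nothing; its unspecified
    value is still symmetric because \<open>hyp\<close> is.\<close>
  define L where "L a b = (THE k. k < length \<pi> \<and> hyp a b \<in> \<pi> ! k)" for a b
  have L_comm: "L a b = L b a" for a b by (simp add: L_def hyp_commute)
  have L_eq: "L a b = k" if "k < length \<pi>" "hyp a b \<in> \<pi> ! k" for a b k
    unfolding L_def using that uniq by (intro the_equality) auto
  have L_in: "L a b < length \<pi> \<and> hyp a b \<in> \<pi> ! L a b" if "E a b" for a b
  proof -
    have "hyp a b \<in> \<Union>(set \<pi>)" unfolding un hyps_def using that by blast
    then obtain k where "k < length \<pi>" "hyp a b \<in> \<pi> ! k" by (auto simp: in_set_conv_nth)
    then show ?thesis using L_eq by metis
  qed
  have block: "\<pi> ! k = MAT_block E L k" if k: "k < length \<pi>" for k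
  proof (intro equalityI subsetI)
    fix H :: "('k ^ 'n) set" assume H: "H \<in> \<pi> ! k"
    then have "H \<in> hyps E" using un k by (metis UnionI nth_mem)
    then obtain a b where "H = hyp a b" "E a b" by (auto simp: hyps_def)
    then show "H \<in> MAT_block E L k" using L_eq[OF k] H by (auto simp: MAT_block_def hyps_def)
  next
    fix H :: "('k ^ 'n) set" assume "H \<in> MAT_block E L k"
    then show "H \<in> \<pi> ! k" using L_in by (auto simp: MAT_block_def hyps_def)
  qed
  have lower: "\<Union>(set (take k \<pi>)) = MAT_lower E L k" if k: "k \<le> length \<pi>" for k
  proof -
    have "\<Union>(set (take k \<pi>)) = (\<Union>i<k. \<pi> ! i)"
      unfolding nth_image[OF k, symmetric] atLeast0LessThan by simp
    also have "\<dots> = (\<Union>i<k. MAT_block E L i)" using block k by simp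
    also have "\<dots> = MAT_lower E L k" by (auto simp: MAT_block_def MAT_lower_def hyps_def)
    finally show ?thesis .
  qed
  have "MAT_conditions E L TYPE('k) k" for k
  proof (cases "k < length \<pi>")
    case True
    then have "let B = \<Union>(set (take k \<pi>)) in arr_rank (\<pi> ! k) = card (\<pi> ! k) \<and>
        \<not> (\<exists>H'\<in>B. \<Inter>(\<pi> ! k) \<subseteq> H') \<and>
        (\<forall>H\<in>\<pi> ! k. int (card B) - int (card (restriction (B \<union> {H}) H)) = int k)"
      using \<pi> unfolding MAT_partition_def by blast
    then show ?thesis
      unfolding MAT_conditions_def Let_def block[OF True] lower[OF less_imp_le[OF True]] .
  next
    case False
    then show ?thesis using L_in E(2) by (intro MAT_conditions_trivial) fastforce+
  qed
  then show ?thesis using mat_labeling_iff_MAT_conditions[of E L, OF E L_comm, where 'k = 'k] by blast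
qed

text \<open>The blocks are the label classes up to the largest label; \<open>initial\<close> makes
  each of them nonempty.\<close>

lemma mat_labeling_imp_MAT_partition:
  fixes E :: "'n::finite \<Rightarrow> 'n \<Rightarrow> bool"
  assumes lab: "mat_labeling E L"
    and initial: "\<And>a b k. E a b \<Longrightarrow> k \<le> L a b \<Longrightarrow> \<exists>c d. E c d \<and> L c d = k"
    and nonempty: "hyps E \<noteq> ({} :: ('k::field ^ 'n) set set)"
  shows "\<exists>\<pi>. MAT_partition (hyps E :: ('k ^ 'n) set set) \<pi>"
proof -
  interpret mat_labeling E L by (rule lab)
  let ?labels = "(\<lambda>(a, b). L a b) ` {(a, b). E a b}"
  have "?labels \<noteq> {}" using nonempty by (auto simp: hyps_def)
  then have "Max ?labels \<in> ?labels" by (intro Max_in) auto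
  then obtain a0 b0 where max: "E a0 b0" "Max ?labels = L a0 b0" by auto
  have le_max: "L a b \<le> L a0 b0" if "E a b" for a b
    unfolding max(2)[symmetric] using that by (intro Max_ge) auto
  define N where "N = Suc (L a0 b0)"
  let ?block = "MAT_block E L :: nat \<Rightarrow> ('k ^ 'n) set set"
  define \<pi> where "\<pi> = map ?block [0..<N]"
  have ne: "?block k \<noteq> {}" if "k < N" for k
    using initial[OF max(1), of k] that by (auto simp: N_def MAT_block_def hyps_def)
  have disj: "i = j" if H: "H \<in> ?block i" "H \<in> ?block j" for i j H
  proof -
    obtain a b where ab: "H = hyp a b" "E a b" "L a b = i" using H(1) by (auto simp: MAT_block_def hyps_def)
    have "symp (\<lambda>a b. E a b \<and> L a b = j)" "irreflp (\<lambda>a b. E a b \<and> L a b = j)"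
      using E_commute L_commute by (auto intro!: sympI irreflpI)
    moreover have "a \<noteq> b" using ab by auto
    ultimately show ?thesis
      using H(2) ab hyp_in_hyps_iff[of "\<lambda>a b. E a b \<and> L a b = j" a b, where 'k = 'k]
      by (auto simp: MAT_block_def)
  qed
  have un: "(\<Union>i<k. ?block i) = MAT_lower E L k" for k
    by (auto simp: MAT_block_def MAT_lower_def hyps_def)
  have "partition_on (hyps E) (set \<pi>)"
  proof (rule partition_onI)
    have "MAT_lower E L N = (hyps E :: ('k ^ 'n) set set)"
      using le_max by (force simp: MAT_lower_def hyps_def N_def less_Suc_eq_le)
    then show "\<Union>(set \<pi>) = hyps E" using un[of N] by (simp add: \<pi>_def atLeast0LessThan)
    show "disjnt p q" if pq: "p \<in> set \<pi>" "q \<in> set \<pi>" "p \<noteq> q" for p q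
    proof -
      obtain i where i: "p = ?block i" using pq(1) by (auto simp: \<pi>_def)
      obtain j where j: "q = ?block j" using pq(2) by (auto simp: \<pi>_def)
      have "H \<notin> q" if "H \<in> p" for H using disj[of H i j] that pq(3) i j by auto
      then show ?thesis by (auto simp: disjnt_def)
    qed
    show "{} \<notin> set \<pi>" using ne by (force simp: \<pi>_def)
  qed
  moreover have "distinct \<pi>"
  proof -
    have "inj_on ?block {0..<N}"
    proof (rule inj_onI)
      fix i j assume ij: "i \<in> {0..<N}" "j \<in> {0..<N}" "?block i = ?block j"
      then obtain H where "H \<in> ?block i" using ne[of i] by auto
      then show "i = j" using ij(3) disj[of H i j] by simp
    qed
    then show ?thesis by (simp add: \<pi>_def distinct_map)
  qed
  moreover have "arrangement (hyps E :: ('k ^ 'n) set set)"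
    unfolding arrangement_def
  proof (intro conjI ballI finite_hyps)
    fix H :: "('k ^ 'n) set" assume "H \<in> hyps E"
    then obtain a b where "H = hyp a b" "E a b" by (auto simp: hyps_def)
    moreover from this have "a \<noteq> b" by auto
    ultimately show "linear_hyperplane H" using hyperplane_hyp by simp
  qed
  moreover have "let B = \<Union>(set (take k \<pi>)) in arr_rank (\<pi> ! k) = card (\<pi> ! k) \<and>
        \<not> (\<exists>H'\<in>B. \<Inter>(\<pi> ! k) \<subseteq> H') \<and>
        (\<forall>H\<in>\<pi> ! k. int (card B) - int (card (restriction (B \<union> {H}) H)) = int k)" if k: "k < length \<pi>" for k
  proof -
    have "\<pi> ! k = ?block k" using k by (simp add: \<pi>_def)
    moreover have "\<Union>(set (take k \<pi>)) = MAT_lower E L k"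
      using k un[of k] by (simp add: \<pi>_def take_map atLeast0LessThan)
    moreover have "MAT_conditions E L TYPE('k) k"
      using lab mat_labeling_iff_MAT_conditions[of E L, OF E_sym E_irrefl L_commute, where 'k = 'k] by blast
    ultimately show ?thesis unfolding MAT_conditions_def Let_def by metis
  qed
  ultimately show ?thesis unfolding MAT_partition_def using nonempty by blast
qed

theorem theorem2p10:
  fixes G :: "'n::finite graph"
  assumes "finite_simple_graph G" and "verts G = UNIV"
  shows "MAT_free (graphic_arrangement G :: ('k::field ^ 'n) set set) \<longleftrightarrow> strongly_chordal G"
proof -
  define E where "E = (\<lambda>a b. {a, b} \<in> edges G)"
  have A: "graphic_arrangement G = (hyps E :: ('k ^ 'n) set set)"
    by (simp add: graphic_arrangement_def hyps_def hyp_def E_def)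
  have E: "symp E" "irreflp E" unfolding E_def
    using assms(1) by (auto intro!: sympI irreflpI simp: insert_commute finite_simple_graph_def)
  have E_iff: "E a b \<longleftrightarrow> {a, b} \<in> edges G" for a b by (simp add: E_def)
  \<comment> \<open>The empty arrangement is MAT-free without a partition, so the labeling of its
    edgeless graph has to be supplied separately.\<close>
  have empty: "mat_labeling E (\<lambda>_ _. 0)" if "hyps E = ({} :: ('k ^ 'n) set set)"
  proof -
    have "\<not> E a b" for a b using that by (auto simp: hyps_def)
    then show ?thesis using E by unfold_locales auto
  qed
  show ?thesis
  proof
    assume "MAT_free (graphic_arrangement G :: ('k ^ 'n) set set)"
    then have "\<exists>L. mat_labeling E L"
      unfolding MAT_free_def A using empty MAT_partition_imp_mat_labeling[OF E, where 'k = 'k] by blast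
    then show "strongly_chordal G" using strongly_chordal_if_mat_labeling[OF assms E_iff] by blast
  next
    assume "strongly_chordal G"
    then obtain L where "mat_labeling E L" "\<forall>a b k. E a b \<longrightarrow> k \<le> L a b \<longrightarrow> (\<exists>c d. E c d \<and> L c d = k)"
      using mat_labeling_if_strongly_chordal[OF assms E_iff] by blast
    then show "MAT_free (graphic_arrangement G :: ('k ^ 'n) set set)"
      unfolding MAT_free_def A using mat_labeling_imp_MAT_partition[of E L, where 'k = 'k] by blast
  qed
qed

end
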